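(* Let $p=(p_k)_{k\in\mathbb{N}_0}$ be a probability distribution on $\mathbb{N}_0$ satisfying $$\sum_{k\in\mathbb{N}} (k\log k)\,p_k<\infty,\qquad p_0=0,\qquad p_1<1,$$ and let $\mathcal{T}_\infty$ be the infinite Galton-Watson tree with offspring distribution $p$. (a) For each $\chi\in\{-,0,+\}$ there exists a (deterministic) constant $f^\chi$ such that $$\lim_{m\to\infty}\frac{N_m^\chi}{N_m}=f^\chi\qquad \mathbb{P}\text{-a.s.}$$ (b) For $k\in\mathbb{N}$, let $S_k=\sum_{l=1}^k X_l$, where $(X_l)_{l=1}^k$ are drawn independently from $p$, and let $\tilde X$ be drawn independently (of these) from the size-biased distribution $\tilde p$. Then, for each $\chi\in\{-,0,+\}$, $$f^\chi=\sum_{k\in\mathbb{N}_0}p_k\,\mathbb{P}\Big(\mathrm{sign}\big[\tilde X+S_k-k(k+1)\big]=\chi\Big).$$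
   Context: The Galton-Watson tree $\mathcal{T}_\infty$ is rooted at $\phi$; each vertex independently has a number of children with distribution $p$; it is defined on a probability space with probability measure $\mathbb{P}$. The mean is $\mu=\sum_{k}kp_k$, and the size-biased distribution is $\tilde p=(\tilde p_k)_{k\in\mathbb{N}_0}$ with $\tilde p_k=kp_k/\mu$. Empty sums are $0$, so $S_0=0$. For a vertex $u$ of $\mathcal{T}_\infty$ with degree $d_u$ in $\mathcal{T}_\infty$, the friendship-bias of $u$ is $\frac{1}{d_u}\sum_{v\sim u}d_v-d_u$, where $v\sim u$ means $v$ is adjacent to $u$ in $\mathcal{T}_\infty$. The vertex $u$ has type $+$, $0$ or $-$ in $\mathcal{T}_\infty$ according to whether its friendship-bias is $>0$, $=0$ or $<0$. Similarly, $\mathrm{sign}[x]$ is $+$, $0$, $-$ according to whether $x>0$, $x=0$, $x<0$. For $m\in\mathbb{N}_0$, $N_m$ is the number of vertices of $\mathcal{T}_\infty$ at graph distance $\le m$ from the root $\phi$, and $N_m^\chi$ is the number of vertices at graph distance $\le m$ from $\phi$ that have type $\chi$ in $\mathcal{T}_\infty$ (the type being computed using degrees in the infinite tree). *)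

theory Defs
  imports "HOL-Probability.Probability"
begin

text \<open>
  Vertices carry Ulam--Harris labels: \<open>[]\<close> is the root and \<open>u @ [i]\<close>, for \<open>i < c u\<close>, are the
  children of \<open>u\<close>, where \<open>c u\<close> is the number of children of \<open>u\<close>. The Galton--Watson tree with
  offspring distribution \<open>p\<close> is the random tree obtained for \<open>c = (\<lambda>u. \<xi> u \<omega>)\<close>, where the family
  \<open>\<xi>\<close>, indexed by all labels, is i.i.d. with law \<open>p\<close>.
\<close>

inductive_set tree_verts :: "(nat list \<Rightarrow> nat) \<Rightarrow> nat list set" for c :: "nat list \<Rightarrow> nat" where
  root: "[] \<in> tree_verts c"
| child: "u \<in> tree_verts c \<Longrightarrow> i < c u \<Longrightarrow> u @ [i] \<in> tree_verts c"

definition tree_edges :: "(nat list \<Rightarrow> nat) \<Rightarrow> (nat list \<times> nat list) set" where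
  "tree_edges c = {(u, v). u \<in> tree_verts c \<and> v \<in> tree_verts c \<and>
     (\<exists>i. v = u @ [i] \<or> u = v @ [i])}"

definition neighbours :: "(nat list \<Rightarrow> nat) \<Rightarrow> nat list \<Rightarrow> nat list set" where
  "neighbours c u = {v. (u, v) \<in> tree_edges c}"

definition degree :: "(nat list \<Rightarrow> nat) \<Rightarrow> nat list \<Rightarrow> nat" where
  "degree c u = card (neighbours c u)"

definition graph_dist :: "(nat list \<Rightarrow> nat) \<Rightarrow> nat list \<Rightarrow> nat list \<Rightarrow> nat" where
  "graph_dist c u v = (LEAST n. (u, v) \<in> tree_edges c ^^ n)"

definition friendship_bias :: "(nat list \<Rightarrow> nat) \<Rightarrow> nat list \<Rightarrow> real" where
  "friendship_bias c u =
     1 / real (degree c u) * (\<Sum>v\<in>neighbours c u. real (degree c v)) - real (degree c u)"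

definition ball_verts :: "(nat list \<Rightarrow> nat) \<Rightarrow> nat \<Rightarrow> nat list set" where
  "ball_verts c m = {u \<in> tree_verts c. graph_dist c [] u \<le> m}"

definition N_total :: "(nat list \<Rightarrow> nat) \<Rightarrow> nat \<Rightarrow> nat" where
  "N_total c m = card (ball_verts c m)"

text \<open>The types \<open>-\<close>, \<open>0\<close>, \<open>+\<close> are encoded as the values \<open>-1\<close>, \<open>0\<close>, \<open>1\<close> of \<^const>\<open>sgn\<close>.\<close>

definition N_type :: "(nat list \<Rightarrow> nat) \<Rightarrow> real \<Rightarrow> nat \<Rightarrow> nat" where
  "N_type c \<tau> m = card {u \<in> ball_verts c m. sgn (friendship_bias c u) = \<tau>}"

definition pmf_mean :: "nat pmf \<Rightarrow> real" where
  "pmf_mean p = (\<Sum>k. real k * pmf p k)"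

text \<open>Only meaningful when the mean is finite and positive; see \<open>pmf_size_biased\<close> below.\<close>

definition size_biased :: "nat pmf \<Rightarrow> nat pmf" where
  "size_biased p = embed_pmf (\<lambda>k. real k * pmf p k / pmf_mean p)"

lemma pmf_size_biased:
  assumes "summable (\<lambda>k. real k * pmf p k)" and "pmf p 0 < 1"
  shows "pmf (size_biased p) k = real k * pmf p k / pmf_mean p"
proof -
  have ex: "\<exists>j>0. pmf p j \<noteq> 0"
  proof (rule ccontr)
    assume *: "\<not> ?thesis"
    have "set_pmf p \<subseteq> {0}"
      using * by (auto simp: set_pmf_iff)
    then have "p = return_pmf 0"
      by (simp add: set_pmf_subset_singleton)
    with assms(2) show False by simp
  qed
  then obtain j where j: "j > 0" "pmf p j \<noteq> 0" by blast
  then have "pmf p j > 0" by (simp add: pmf_pos)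
  with j have pos: "pmf_mean p > 0"
    unfolding pmf_mean_def by (intro suminf_pos2[OF assms(1), of j]) auto
  have "(\<integral>\<^sup>+ k. ennreal (real k * pmf p k / pmf_mean p) \<partial>count_space UNIV)
      = (\<Sum>k. ennreal (real k * pmf p k / pmf_mean p))"
    by (rule nn_integral_count_space_nat)
  also have "\<dots> = ennreal (\<Sum>k. real k * pmf p k / pmf_mean p)"
    using pos by (intro suminf_ennreal2 summable_divide assms(1)) auto
  also have "(\<Sum>k. real k * pmf p k / pmf_mean p) = 1"
    using pos suminf_divide[OF assms(1), of "pmf_mean p"] by (simp add: pmf_mean_def)
  finally show ?thesis
    unfolding size_biased_def using pos by (intro pmf_embed_pmf) auto
qed

lemma tree_edges_length:
  assumes "([], u) \<in> tree_edges c ^^ n"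
  shows "length u \<le> n"
  using assms
proof (induction n arbitrary: u)
  case (Suc n)
  then obtain v where v: "([], v) \<in> tree_edges c ^^ n" "(v, u) \<in> tree_edges c" by auto
  from Suc.IH[OF v(1)] v(2) show ?case by (auto simp: tree_edges_def)
qed simp

lemma graph_dist_root:
  assumes "u \<in> tree_verts c"
  shows "graph_dist c [] u = length u"
proof -
  have "([], u) \<in> tree_edges c ^^ length u"
    using assms
  proof induction
    case (child u i)
    then have "(u, u @ [i]) \<in> tree_edges c"
      by (auto simp: tree_edges_def intro: tree_verts.child)
    with child.IH show ?case by auto
  qed simp
  then show ?thesis
    unfolding graph_dist_def by (intro Least_equality tree_edges_length)
qed

end

theory Submission
  imports Defs
begin

text \<open>
  Let \<open>Z\<^sub>n\<close> be the size of generation \<open>n\<close>. A vertex of depth at least \<open>2\<close> with \<open>k\<close>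
  children has degree \<open>k + 1\<close>, and after multiplication by the degree its friendship-bias is
  \<open>y + S - k (k + 1)\<close>, where \<open>y\<close> is the number of children of its parent and \<open>S\<close> the number of
  its own grandchildren (\<open>sgn_friendship_bias\<close>). Its type is thus read off from the subtree at its parent,
  and for \<open>n \<ge> 1\<close> the number of vertices of type \<open>\<tau>\<close> in generation \<open>n + 1\<close> is the sum over the vertices \<open>v\<close> of
  generation \<open>n\<close> of a functional \<open>type_count \<tau>\<close> of the subtree at \<open>v\<close>. Grouping siblings in
  this way is what produces the size-biased law: a parent with \<open>y\<close> children is counted \<open>y\<close> times.

  Given generation \<open>n\<close>, the subtrees at its vertices are i.i.d. copies of the whole tree, so a law
  of large numbers is expected: for a tree functional \<open>h\<close> dominated by the number of children
  of the root, the average of \<open>h\<close> over generation \<open>n\<close> tends to its expectation almost surely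
  (\<open>AE_gen_average_tendsto\<close>). With \<open>h\<close> the number of children of the root this says
  \<open>Z\<^sub>n\<^sub>+\<^sub>1 / Z\<^sub>n \<longlonglongrightarrow> \<mu>\<close>; with \<open>h = type_count \<tau>\<close> it gives the numerator. Hence the fraction of type \<open>\<tau>\<close> in
  generation \<open>n\<close> converges to \<open>E[type_count \<tau>] / \<mu>\<close>, and so does the fraction in the ball,
  by the Stolz--Cesaro theorem (\<open>ratio_of_sums_tendsto\<close>).

  The law of large numbers holds because averages over a generation are controlled by two
  expectations that sum to a finite value over \<open>n\<close>. Split \<open>h\<close> according to whether the root has at
  most \<open>b\<^sup>n\<close> children. The average of the large part has expectation at most
  \<open>E[X; X > b\<^sup>n]\<close> with \<open>X\<close> of law \<open>p\<close>, whatever \<open>Z\<^sub>n\<close> is; summed over \<open>n\<close> this is of order \<open>E[X (1 + log X)]\<close>, and it is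
  here that the moment hypothesis enters. The average of the small part has variance at most
  \<open>\<mu> b\<^sup>n E[1 / Z\<^sub>n]\<close>. By the inequality between the harmonic and the arithmetic mean,
  \<open>E[1 / Z\<^sub>n] \<le> E[1 / X]\<^sup>n \<le> ((1 + p\<^sub>1) / 2)\<^sup>n\<close> (\<open>nn_integral_inverse_card_gen_le\<close>), which decays
  exponentially since \<open>p\<^sub>1 < 1\<close>; choosing \<open>b > 1\<close> close enough to \<open>1\<close> makes the product
  summable.

  All of this is carried out on the product space of labellings \<open>c\<close> with i.i.d. coordinates and
  transported to the given family \<open>\<xi>\<close> at the end (\<open>distr_iid_family\<close>).
\<close>

section \<open>Generations and types in a fixed tree\<close>

definition gen :: "(nat list \<Rightarrow> nat) \<Rightarrow> nat \<Rightarrow> nat list set" where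
  "gen c n = {u \<in> tree_verts c. length u = n}"

definition subtree :: "(nat list \<Rightarrow> nat) \<Rightarrow> nat list \<Rightarrow> nat list \<Rightarrow> nat" where
  "subtree c v = (\<lambda>w. c (v @ w))"

lemma subtree_apply [simp]: "subtree c v w = c (v @ w)"
  by (simp add: subtree_def)

lemma snoc_in_tree_iff: "u @ [i] \<in> tree_verts c \<longleftrightarrow> u \<in> tree_verts c \<and> i < c u"
  by (auto elim: tree_verts.cases intro: tree_verts.child)

lemma gen_0: "gen c 0 = {[]}"
  by (auto simp: gen_def intro: tree_verts.root)

lemma gen_Suc: "gen c (Suc n) = (\<lambda>(u, i). u @ [i]) ` (SIGMA u:gen c n. {..<c u})"
proof -
  have "w \<in> gen c (Suc n) \<longleftrightarrow> (\<exists>u i. w = u @ [i] \<and> u \<in> gen c n \<and> i < c u)" for w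
    by (cases w rule: rev_cases) (auto simp: gen_def snoc_in_tree_iff)
  then show ?thesis
    by (auto simp: image_iff)
qed

lemma finite_gen [simp]: "finite (gen c n)"
  by (induction n) (auto simp: gen_0 gen_Suc)

lemma sum_gen_Suc:
  "(\<Sum>w\<in>gen c (Suc n). g w) = (\<Sum>u\<in>gen c n. \<Sum>i<c u. g (u @ [i]))"
proof -
  have "inj_on (\<lambda>(u, i). u @ [i]) (SIGMA u:gen c n. {..<c u})"
    by (auto simp: inj_on_def)
  then show ?thesis
    by (simp add: gen_Suc sum.reindex sum.Sigma case_prod_unfold)
qed

lemma card_gen_Suc: "card (gen c (Suc n)) = (\<Sum>u\<in>gen c n. c u)"
  using sum_gen_Suc[of "\<lambda>_. 1 :: nat" c n] by simp

text \<open>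
  This locality is what makes generation \<open>n\<close> independent of the subtrees at its vertices.
\<close>

lemma gen_cong:
  assumes "\<And>u. length u < n \<Longrightarrow> c u = c' u"
  shows "gen c n = gen c' n"
  using assms
proof (induction n)
  case (Suc n)
  then have "gen c n = gen c' n" "\<And>u. u \<in> gen c' n \<Longrightarrow> c u = c' u"
    by (auto simp: gen_def)
  then show ?case
    by (simp add: gen_Suc cong: Sigma_cong)
qed (simp add: gen_0)

lemma card_gen_pos:
  assumes "\<And>u. c u \<noteq> 0"
  shows "card (gen c n) > 0"
proof (induction n)
  case (Suc n)
  then obtain u where "u \<in> gen c n"
    by (auto simp: card_gt_0_iff)
  then have "u @ [0] \<in> gen c (Suc n)"
    using assms[of u] by (auto simp: gen_def snoc_in_tree_iff)
  then show ?case
    by (auto simp: card_gt_0_iff)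
qed (simp add: gen_0)

lemma ball_verts_eq: "ball_verts c m = (\<Union>n\<le>m. gen c n)"
  by (auto simp: ball_verts_def gen_def graph_dist_root)

lemma N_total_eq: "N_total c m = (\<Sum>n\<le>m. card (gen c n))"
  unfolding N_total_def ball_verts_eq
  by (rule card_UN_disjoint) (auto, auto simp: gen_def)

lemma N_type_eq:
  "N_type c \<tau> m = (\<Sum>n\<le>m. card {u \<in> gen c n. sgn (friendship_bias c u) = \<tau>})"
proof -
  have "{u \<in> ball_verts c m. sgn (friendship_bias c u) = \<tau>}
      = (\<Union>n\<le>m. {u \<in> gen c n. sgn (friendship_bias c u) = \<tau>})"
    by (auto simp: ball_verts_eq)
  then show ?thesis
    unfolding N_type_def
    by (simp only:) (rule card_UN_disjoint, auto, auto simp: gen_def)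
qed

lemma neighbours_nonroot:
  assumes "v @ [i] \<in> tree_verts c"
  shows "neighbours c (v @ [i]) = insert v ((\<lambda>j. v @ [i, j]) ` {..<c (v @ [i])})"
proof -
  have "v @ [i, j] \<in> tree_verts c \<longleftrightarrow> j < c (v @ [i])" for j
    using assms snoc_in_tree_iff[of "v @ [i]" j c] by simp
  then show ?thesis
    using assms by (auto simp: neighbours_def tree_edges_def snoc_in_tree_iff)
qed

lemma degree_nonroot:
  assumes "v @ [i] \<in> tree_verts c"
  shows "degree c (v @ [i]) = c (v @ [i]) + 1"
proof -
  have "inj_on (\<lambda>j. v @ [i, j]) {..<c (v @ [i])}"
    by (auto simp: inj_on_def)
  moreover have "v \<notin> (\<lambda>j. v @ [i, j]) ` {..<c (v @ [i])}"
    by auto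
  ultimately show ?thesis
    by (simp add: degree_def neighbours_nonroot[OF assms] card_image)
qed

text \<open>
  The type of the child \<open>[i]\<close> of the root, computed as if the root had a parent and hence degree
  \<open>c [] + 1\<close>. This is the situation in the subtree at a vertex \<open>v \<noteq> []\<close> of a larger tree.
\<close>

definition child_type :: "(nat list \<Rightarrow> nat) \<Rightarrow> nat \<Rightarrow> real" where
  "child_type c i =
     sgn (real (c []) + (\<Sum>j<c [i]. real (c [i, j])) - real (c [i]) * (real (c [i]) + 1))"

text \<open>
  With \<open>k\<close> children the vertex has degree \<open>k + 1\<close>, and its neighbours have total degree
  \<open>(y + 1) + (S + k)\<close>; multiplying the bias by \<open>k + 1\<close> leaves \<open>y + S - k (k + 1)\<close>. The parent
  must not be the root, whose degree lacks the summand \<open>1\<close>.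
\<close>

lemma sgn_friendship_bias:
  assumes "v @ [i] \<in> tree_verts c" and "v \<noteq> []"
  shows "sgn (friendship_bias c (v @ [i])) = child_type (subtree c v) i"
proof -
  let ?k = "c (v @ [i])"
  obtain w a where v: "v = w @ [a]"
    using assms(2) by (cases v rule: rev_cases) auto
  have deg_v: "degree c v = c v + 1"
    using assms(1) degree_nonroot[of w a c] unfolding v snoc_in_tree_iff by simp
  have deg_child: "degree c (v @ [i, j]) = c (v @ [i, j]) + 1" if "j < ?k" for j
    using that assms(1) degree_nonroot[of "v @ [i]" j c] snoc_in_tree_iff[of "v @ [i]" j c] by simp
  have "(\<Sum>x\<in>neighbours c (v @ [i]). real (degree c x))
      = real (degree c v) + (\<Sum>x\<in>(\<lambda>j. v @ [i, j]) ` {..<?k}. real (degree c x))"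
    by (simp add: neighbours_nonroot[OF assms(1)]) (subst sum.insert; auto)
  also have "(\<Sum>x\<in>(\<lambda>j. v @ [i, j]) ` {..<?k}. real (degree c x))
      = (\<Sum>j<?k. real (degree c (v @ [i, j])))"
    by (subst sum.reindex) (auto simp: inj_on_def)
  also have "\<dots> = (\<Sum>j<?k. real (c (v @ [i, j])) + 1)"
    by (intro sum.cong) (auto simp: deg_child)
  finally have nb: "(\<Sum>x\<in>neighbours c (v @ [i]). real (degree c x))
      = real (c v) + 1 + (\<Sum>j<?k. real (c (v @ [i, j]))) + real ?k"
    by (simp add: deg_v sum.distrib)
  have "friendship_bias c (v @ [i])
      = (real (c v) + (\<Sum>j<?k. real (c (v @ [i, j]))) - real ?k * (real ?k + 1)) / (real ?k + 1)"
    unfolding friendship_bias_def nb degree_nonroot[OF assms(1)]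
    by (simp add: field_simps)
  then show ?thesis
    by (simp add: child_type_def sgn_divide)
qed

definition type_count :: "real \<Rightarrow> (nat list \<Rightarrow> nat) \<Rightarrow> nat" where
  "type_count \<tau> c = card {i. i < c [] \<and> child_type c i = \<tau>}"

lemma card_type_gen_Suc:
  assumes "n > 0"
  shows "card {u \<in> gen c (Suc n). sgn (friendship_bias c u) = \<tau>}
       = (\<Sum>v\<in>gen c n. type_count \<tau> (subtree c v))"
proof -
  have "card {u \<in> gen c (Suc n). sgn (friendship_bias c u) = \<tau>}
      = (\<Sum>u\<in>gen c (Suc n). if sgn (friendship_bias c u) = \<tau> then 1 else 0)"
    by (simp add: sum.If_cases Int_def conj_commute)
  also have "\<dots> = (\<Sum>v\<in>gen c n. \<Sum>i<c v. if child_type (subtree c v) i = \<tau> then 1 else 0)"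
    unfolding sum_gen_Suc using assms
    by (intro sum.cong refl if_cong arg_cong[where f = "\<lambda>x. x = \<tau>"] sgn_friendship_bias)
       (auto simp: gen_def snoc_in_tree_iff)
  also have "\<dots> = (\<Sum>v\<in>gen c n. type_count \<tau> (subtree c v))"
    by (intro sum.cong) (simp_all add: type_count_def sum.If_cases Int_def)
  finally show ?thesis .
qed

lemma type_count_le: "type_count \<tau> c \<le> c []"
proof -
  have "card {i. i < c [] \<and> child_type c i = \<tau>} \<le> card {..<c []}"
    by (intro card_mono) auto
  then show ?thesis
    by (simp add: type_count_def)
qed

text \<open>
  The Stolz--Cesaro theorem: since the denominators diverge, the finitely many terms whose ratio is
  still far from the limit do not matter.
\<close>

lemma ratio_of_sums_tendsto:
  fixes a b :: "nat \<Rightarrow> real"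
  assumes b: "\<And>n. b n > 0" and div: "\<not> summable b"
    and lim: "(\<lambda>n. a n / b n) \<longlonglongrightarrow> L"
  shows "(\<lambda>m. (\<Sum>n\<le>m. a n) / (\<Sum>n\<le>m. b n)) \<longlonglongrightarrow> L"
proof (rule LIMSEQ_I)
  fix r :: real assume r: "r > 0"
  let ?B = "\<lambda>m. \<Sum>n\<le>m. b n"
  have Bpos: "?B m > 0" for m
    using b by (intro sum_pos) auto
  have B_top: "filterlim ?B at_top sequentially"
    unfolding filterlim_at_top eventually_sequentially
  proof (rule allI, rule ccontr)
    fix Z assume "\<not> (\<exists>N. \<forall>m\<ge>N. Z \<le> ?B m)"
    then have *: "\<exists>m\<ge>N. ?B m < Z" for N
      by (meson not_le)
    have "(\<Sum>n<k. b n) \<le> Z" for k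
    proof -
      obtain m where m: "m \<ge> k" "?B m < Z"
        using * by blast
      have "(\<Sum>n<k. b n) \<le> ?B m"
        using m(1) b by (intro sum_mono2) (auto intro: less_imp_le)
      with m(2) show ?thesis
        by simp
    qed
    then have "summable b"
      using b by (intro summableI_nonneg_bounded[where x = Z]) (auto intro: less_imp_le)
    with div show False ..
  qed
  obtain N where N: "\<And>n. n \<ge> N \<Longrightarrow> \<bar>a n / b n - L\<bar> < r / 2"
    using LIMSEQ_D[OF lim, of "r / 2"] r by auto
  define K where "K = (\<Sum>n<N. \<bar>a n - L * b n\<bar>)"
  have "eventually (\<lambda>m. ?B m > 2 * K / r) sequentially"
    using B_top by (simp add: filterlim_at_top_dense)
  then obtain M where M: "\<And>m. m \<ge> M \<Longrightarrow> ?B m > 2 * K / r"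
    by (auto simp: eventually_sequentially)
  have "norm ((\<Sum>n\<le>m. a n) / ?B m - L) < r" if "m \<ge> M" for m
  proof -
    have "\<bar>\<Sum>n\<le>m. a n - L * b n\<bar> \<le> (\<Sum>n\<le>m. \<bar>a n - L * b n\<bar>)"
      by (rule sum_abs)
    also have "\<dots> \<le> (\<Sum>n\<le>m. (if n < N then \<bar>a n - L * b n\<bar> else 0) + r / 2 * b n)"
    proof (rule sum_mono)
      fix n
      have "\<bar>a n - L * b n\<bar> \<le> r / 2 * b n" if "n \<ge> N"
      proof -
        have "\<bar>a n - L * b n\<bar> = \<bar>a n / b n - L\<bar> * b n"
          using b[of n] by (simp add: abs_if field_simps)
        also have "\<dots> \<le> r / 2 * b n"
          using N[OF that] b[of n] by (intro mult_right_mono) auto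
        finally show ?thesis .
      qed
      then show "\<bar>a n - L * b n\<bar> \<le> (if n < N then \<bar>a n - L * b n\<bar> else 0) + r / 2 * b n"
        using b[of n] r by (cases "n < N") auto
    qed
    also have "\<dots> = (\<Sum>n\<le>m. if n < N then \<bar>a n - L * b n\<bar> else 0) + r / 2 * ?B m"
      by (simp add: sum.distrib sum_distrib_left)
    also have "(\<Sum>n\<le>m. if n < N then \<bar>a n - L * b n\<bar> else 0) \<le> K"
      unfolding K_def by (subst sum.If_cases) (auto intro!: sum_mono2)
    finally have "\<bar>\<Sum>n\<le>m. a n - L * b n\<bar> \<le> K + r / 2 * ?B m"
      by simp
    also have "\<dots> < r * ?B m"
      using M[OF that] r by (simp add: field_simps)
    finally have *: "\<bar>\<Sum>n\<le>m. a n - L * b n\<bar> < r * ?B m" .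
    have "(\<Sum>n\<le>m. a n) / ?B m - L = (\<Sum>n\<le>m. a n - L * b n) / ?B m"
      using Bpos[of m] by (simp add: sum_subtractf sum_distrib_left[symmetric] field_simps)
    then show ?thesis
      using * Bpos[of m] by (simp add: field_simps)
  qed
  then show "\<exists>no. \<forall>m\<ge>no. norm ((\<Sum>n\<le>m. a n) / ?B m - L) < r"
    by blast
qed

section \<open>The product space of labelled trees\<close>

definition tree_space :: "nat pmf \<Rightarrow> (nat list \<Rightarrow> nat) measure" where
  "tree_space p = PiM UNIV (\<lambda>_. measure_pmf p)"

lemma prob_space_tree_space: "prob_space (tree_space p)"
  unfolding tree_space_def by (intro prob_space_PiM measure_pmf.prob_space_axioms)

lemma space_tree_space [simp]: "space (tree_space p) = UNIV"
  by (simp add: tree_space_def space_PiM)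

lemma sets_tree_space: "sets (tree_space p) = sets (PiM UNIV (\<lambda>_. count_space UNIV))"
  unfolding tree_space_def by (intro sets_PiM_cong) simp_all

lemma measurable_tree_space_iff:
  "f \<in> M \<rightarrow>\<^sub>M tree_space p \<longleftrightarrow> f \<in> M \<rightarrow>\<^sub>M PiM UNIV (\<lambda>_. count_space UNIV)"
  by (simp only: measurable_cong_sets[OF refl sets_tree_space])

lemma measurable_into_tree_space:
  assumes "\<And>u. (\<lambda>x. f x u) \<in> M \<rightarrow>\<^sub>M count_space UNIV"
  shows "f \<in> M \<rightarrow>\<^sub>M tree_space p"
  unfolding measurable_tree_space_iff
  using measurable_PiM_single'[of UNIV "\<lambda>u x. f x u" M "\<lambda>_. count_space UNIV"] assms
  by simp

lemma measurable_offspring [measurable]: "(\<lambda>c. c u) \<in> tree_space p \<rightarrow>\<^sub>M count_space UNIV"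
  using measurable_component_singleton[of u UNIV "\<lambda>_. count_space (UNIV :: nat set)"]
  by (simp add: measurable_cong_sets[OF sets_tree_space refl])

lemma measurable_subtree [measurable]:
  "(\<lambda>c. subtree c v) \<in> tree_space p \<rightarrow>\<^sub>M tree_space p"
  by (rule measurable_into_tree_space) simp

lemma distr_relabel:
  assumes "inj_on e I"
  shows "distr (tree_space p) (PiM I (\<lambda>_. measure_pmf p)) (\<lambda>c. \<lambda>i\<in>I. c (e i)) = PiM I (\<lambda>_. measure_pmf p)"
  unfolding tree_space_def
  using assms by (intro distr_PiM_reindex measure_pmf.prob_space_axioms) auto

text \<open>
  The prefix map \<open>w \<mapsto> v @ w\<close> is injective, so it only selects a subfamily of the i.i.d. labels.
\<close>

lemma distr_subtree: "distr (tree_space p) (tree_space p) (\<lambda>c. subtree c v) = tree_space p"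
  using distr_relabel[of "\<lambda>w. v @ w" UNIV p]
  by (simp add: tree_space_def[symmetric] subtree_def restrict_UNIV inj_on_def)

lemma distr_offspring: "distr (tree_space p) (count_space UNIV) (\<lambda>c. c u) = measure_pmf p"
proof -
  have "distr (tree_space p) (measure_pmf p) (\<lambda>c. c u) = measure_pmf p"
    unfolding tree_space_def
    by (rule distr_PiM_component) (auto intro: measure_pmf.prob_space_axioms)
  moreover have "distr (tree_space p) (measure_pmf p) (\<lambda>c. c u) = distr (tree_space p) (count_space UNIV) (\<lambda>c. c u)"
    by (rule distr_cong) simp_all
  ultimately show ?thesis
    by simp
qed

lemma nn_integral_subtree:
  assumes [measurable]: "h \<in> borel_measurable (tree_space p)"
  shows "(\<integral>\<^sup>+c. h (subtree c v) \<partial>tree_space p) = (\<integral>\<^sup>+c. h c \<partial>tree_space p)"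
  using nn_integral_distr[OF measurable_subtree[of v p], of h] assms
  by (simp add: distr_subtree)

lemma nn_integral_offspring:
  "(\<integral>\<^sup>+c. h (c u) \<partial>tree_space p) = (\<integral>\<^sup>+k. h k \<partial>measure_pmf p)"
  using nn_integral_distr[OF measurable_offspring[of u p], of h]
  by (simp add: distr_offspring)

text \<open>
  Independence is used in the form that functions reading disjoint sets of labels are independent.
  Keeping the functions on the full space, with the set of labels as a side condition, avoids
  restricting them to partial labellings.
\<close>

definition determined_by :: "nat list set \<Rightarrow> ((nat list \<Rightarrow> nat) \<Rightarrow> 'b) \<Rightarrow> bool" where
  "determined_by A f \<longleftrightarrow> (\<forall>c c'. (\<forall>u\<in>A. c u = c' u) \<longrightarrow> f c = f c')"

lemma indep_vars_offspring:
  "prob_space.indep_vars (tree_space p) (\<lambda>_. count_space UNIV) (\<lambda>u c. c u) UNIV"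
proof -
  interpret prob_space "tree_space p" by (rule prob_space_tree_space)
  have "distr (tree_space p) (PiM UNIV (\<lambda>_. count_space UNIV)) (\<lambda>c. \<lambda>u\<in>UNIV. c u) = tree_space p"
    by (simp add: distr_id2 sets_tree_space restrict_UNIV)
  then show ?thesis
    by (subst indep_vars_iff_distr_eq_PiM) (simp_all add: distr_offspring tree_space_def[symmetric])
qed

text \<open>
  Independence of the coordinates carries over to restrictions to disjoint blocks, and a function
  determined by a block factors through the restriction to it.
\<close>

lemma indep_var_determined_by:
  assumes f: "f \<in> tree_space p \<rightarrow>\<^sub>M N1" "determined_by A f"
    and g: "g \<in> tree_space p \<rightarrow>\<^sub>M N2" "determined_by B g"
    and disj: "A \<inter> B = {}"
  shows "prob_space.indep_var (tree_space p) N1 f N2 g"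
proof -
  interpret prob_space "tree_space p" by (rule prob_space_tree_space)
  have inc: "(\<lambda>c. c) \<in> PiM K (\<lambda>_. count_space UNIV) \<rightarrow>\<^sub>M tree_space p" for K :: "nat list set"
  proof (rule measurable_into_tree_space)
    fix u
    show "(\<lambda>c. c u) \<in> PiM K (\<lambda>_. count_space UNIV) \<rightarrow>\<^sub>M count_space (UNIV :: nat set)"
    proof (cases "u \<in> K")
      case False
      then have "c u = undefined" if "c \<in> space (PiM K (\<lambda>_. count_space (UNIV :: nat set)))" for c
        using that by (auto simp: space_PiM PiE_def extensional_def)
      then show ?thesis
        by (subst measurable_cong[where g = "\<lambda>_. undefined"]) auto
    qed simp
  qed
  have "indep_var N1 (f \<circ> (\<lambda>c. restrict c A)) N2 (g \<circ> (\<lambda>c. restrict c B))"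
    using measurable_compose[OF inc f(1)] measurable_compose[OF inc g(1)]
    by (intro indep_var_compose[OF indep_var_restrict[OF indep_vars_offspring]] disj) auto
  moreover have "f \<circ> (\<lambda>c. restrict c A) = f" "g \<circ> (\<lambda>c. restrict c B) = g"
    using f(2) g(2) by (auto simp: determined_by_def fun_eq_iff)
  ultimately show ?thesis
    by simp
qed

lemma nn_integral_mult_determined_by:
  fixes f g :: "(nat list \<Rightarrow> nat) \<Rightarrow> ennreal"
  assumes f: "f \<in> borel_measurable (tree_space p)" "determined_by A f"
    and g: "g \<in> borel_measurable (tree_space p)" "determined_by B g"
    and disj: "A \<inter> B = {}"
  shows "(\<integral>\<^sup>+c. f c * g c \<partial>tree_space p) = (\<integral>\<^sup>+c. f c \<partial>tree_space p) * (\<integral>\<^sup>+c. g c \<partial>tree_space p)"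
proof -
  interpret prob_space "tree_space p" by (rule prob_space_tree_space)
  have "indep_vars (\<lambda>_. borel) (case_bool f g) UNIV"
    using indep_var_determined_by[OF f g disj] unfolding indep_var_def
    by (rule indep_vars_cong[THEN iffD1, rotated 3]) (auto split: bool.split)
  from indep_vars_nn_integral[OF _ this] show ?thesis
    by (simp add: UNIV_bool mult.commute)
qed

text \<open>
  There are only countably many finite sets of labels, so a random generation can be treated as a
  discrete random variable. The codomain is the set of finite label sets because the space of
  all label sets is uncountable.
\<close>

lemma measurable_gen [measurable]:
  "(\<lambda>c. gen c n) \<in> tree_space p \<rightarrow>\<^sub>M count_space (Collect finite)"
proof -
  have [measurable]: "Measurable.pred (tree_space p) (\<lambda>c. u \<in> gen c n)" for u
  proof (induction n arbitrary: u)
    case (Suc n)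
    show ?case
    proof (cases u rule: rev_cases)
      case (snoc w i)
      have "u \<in> gen c (Suc n) \<longleftrightarrow> w \<in> gen c n \<and> i < c w" for c
        by (auto simp: snoc gen_def snoc_in_tree_iff)
      moreover have "Measurable.pred (tree_space p) (\<lambda>c. i < c w)"
        by (rule measurable_compose[OF measurable_offspring]) simp
      then have "Measurable.pred (tree_space p) (\<lambda>c. w \<in> gen c n \<and> i < c w)"
        by (intro pred_intros_logic Suc.IH)
      ultimately show ?thesis
        by (simp only:)
    qed (simp add: gen_def)
  qed (simp add: gen_0)
  have "{c. gen c n = G} \<in> sets (tree_space p)" for G
  proof -
    have "{c \<in> space (tree_space p). \<forall>u. u \<in> gen c n \<longleftrightarrow> u \<in> G} \<in> sets (tree_space p)"
      by measurable
    then show ?thesis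
      by (simp add: set_eq_iff)
  qed
  then show ?thesis
    by (subst measurable_count_space_eq_countable)
       (auto simp: countable_Collect_finite vimage_def)
qed

lemma measurable_compose_gen:
  assumes "\<And>G. finite G \<Longrightarrow> f G \<in> tree_space p \<rightarrow>\<^sub>M N"
  shows "(\<lambda>c. f (gen c n) c) \<in> tree_space p \<rightarrow>\<^sub>M N"
  by (rule measurable_compose_countable'[where f = f, OF _ measurable_gen countable_Collect_finite])
     (simp add: assms)

lemma measurable_card_gen [measurable]:
  "(\<lambda>c. card (gen c n)) \<in> tree_space p \<rightarrow>\<^sub>M count_space UNIV"
  by (rule measurable_compose_gen[where f = "\<lambda>G _. card G"]) simp

text \<open>
  The branching property. On the event that generation \<open>n\<close> equals a fixed set \<open>G\<close>, which depends on
  labels of length less than \<open>n\<close> only, the integrand \<open>\<Psi> G\<close> reads labels of length at least \<open>n\<close> and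
  may therefore be integrated separately. So an estimate that is valid for every deterministic set
  \<open>G\<close> also holds for the random generation.
\<close>

lemma nn_integral_gen_le:
  fixes \<Psi> :: "nat list set \<Rightarrow> (nat list \<Rightarrow> nat) \<Rightarrow> ennreal"
  assumes meas: "\<And>G. finite G \<Longrightarrow> \<Psi> G \<in> borel_measurable (tree_space p)"
    and det: "\<And>G. finite G \<Longrightarrow> G \<subseteq> {u. length u = n} \<Longrightarrow> determined_by {u. length u \<ge> n} (\<Psi> G)"
    and le: "\<And>G. finite G \<Longrightarrow> G \<subseteq> {u. length u = n} \<Longrightarrow> (\<integral>\<^sup>+c. \<Psi> G c \<partial>tree_space p) \<le> C G"
  shows "(\<integral>\<^sup>+c. \<Psi> (gen c n) c \<partial>tree_space p) \<le> (\<integral>\<^sup>+c. C (gen c n) \<partial>tree_space p)"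
proof -
  let ?I = "\<lambda>G c. indicator {c. gen c n = G} c :: ennreal"
  let ?S = "count_space (Collect finite) :: nat list set measure"
  have I_meas [measurable]: "?I G \<in> borel_measurable (tree_space p)" if "finite G" for G
  proof -
    have "{c \<in> space (tree_space p). gen c n = G} \<in> sets (tree_space p)"
      using measurable_sets[OF measurable_gen[of n p], of "{G}"] that
      by (simp add: vimage_def)
    then show ?thesis by simp
  qed
  \<comment> \<open>The possible values of the generation are countable, so a sum over them commutes with the integral.\<close>
  have split: "F (gen c n) c = (\<integral>\<^sup>+G. ?I G c * F G c \<partial>?S)" for F and c
  proof -
    have "(\<integral>\<^sup>+G. ?I G c * F G c \<partial>?S) = (\<Sum>G\<in>{gen c n}. ?I G c * F G c)"
      by (rule nn_integral_count_space') (auto simp: indicator_def)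
    then show ?thesis by simp
  qed
  have "(\<integral>\<^sup>+c. \<Psi> (gen c n) c \<partial>tree_space p) = (\<integral>\<^sup>+c. \<integral>\<^sup>+G. ?I G c * \<Psi> G c \<partial>?S \<partial>tree_space p)"
    by (simp only: split[of \<Psi>])
  also have "\<dots> = (\<integral>\<^sup>+G. \<integral>\<^sup>+c. ?I G c * \<Psi> G c \<partial>tree_space p \<partial>?S)"
    using meas by (intro nn_integral_count_space_nn_integral countable_Collect_finite) auto
  also have "\<dots> \<le> (\<integral>\<^sup>+G. \<integral>\<^sup>+c. ?I G c * C G \<partial>tree_space p \<partial>?S)"
  proof (rule nn_integral_mono)
    fix G assume "G \<in> space ?S"
    then have fin: "finite G" by simp
    show "(\<integral>\<^sup>+c. ?I G c * \<Psi> G c \<partial>tree_space p) \<le> (\<integral>\<^sup>+c. ?I G c * C G \<partial>tree_space p)"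
    proof (cases "G \<subseteq> {u. length u = n}")
      case True
      have "determined_by {u. length u < n} (?I G)"
        unfolding determined_by_def
      proof (intro allI impI)
        fix c c' :: "nat list \<Rightarrow> nat"
        assume "\<forall>u\<in>{u. length u < n}. c u = c' u"
        then have "gen c n = gen c' n"
          by (intro gen_cong) simp
        then show "?I G c = ?I G c'"
          by (simp add: indicator_def)
      qed
      then have "(\<integral>\<^sup>+c. ?I G c * \<Psi> G c \<partial>tree_space p)
          = (\<integral>\<^sup>+c. ?I G c \<partial>tree_space p) * (\<integral>\<^sup>+c. \<Psi> G c \<partial>tree_space p)"
        by (rule nn_integral_mult_determined_by[OF I_meas[OF fin] _ meas[OF fin] det[OF fin True]]) auto
      also have "\<dots> \<le> (\<integral>\<^sup>+c. ?I G c \<partial>tree_space p) * C G"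
        using le[OF fin True] by (intro mult_left_mono) auto
      also have "\<dots> = (\<integral>\<^sup>+c. ?I G c * C G \<partial>tree_space p)"
        using I_meas[OF fin] by (subst nn_integral_multc) auto
      finally show ?thesis .
    next
      case False
      then have "?I G c = 0" for c
        by (auto simp: indicator_def gen_def)
      then show ?thesis by simp
    qed
  qed
  also have "\<dots> = (\<integral>\<^sup>+c. \<integral>\<^sup>+G. ?I G c * C G \<partial>?S \<partial>tree_space p)"
    by (intro nn_integral_count_space_nn_integral[symmetric] countable_Collect_finite) auto
  also have "\<dots> = (\<integral>\<^sup>+c. C (gen c n) \<partial>tree_space p)"
    by (simp only: split[of "\<lambda>G _. C G"])
  finally show ?thesis .
qed

section \<open>First and second moments over a generation\<close>

text \<open>
  A series of nonnegative functions with finite total integral converges almost everywhere, so its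
  terms tend to \<open>0\<close>. This turns bounds on expectations into almost sure convergence.
\<close>

lemma AE_tendsto_0_of_nn_integral_suminf:
  fixes X :: "nat \<Rightarrow> 'a \<Rightarrow> real"
  assumes meas [measurable]: "\<And>n. X n \<in> borel_measurable M"
    and nonneg: "\<And>n x. X n x \<ge> 0"
    and fin: "(\<Sum>n. \<integral>\<^sup>+x. X n x \<partial>M) < \<infinity>"
  shows "AE x in M. (\<lambda>n. X n x) \<longlonglongrightarrow> 0"
proof -
  have "(\<integral>\<^sup>+x. (\<Sum>n. ennreal (X n x)) \<partial>M) \<noteq> \<infinity>"
    using fin by (subst nn_integral_suminf) auto
  then have "AE x in M. (\<Sum>n. ennreal (X n x)) \<noteq> \<infinity>"
    by (intro nn_integral_PInf_AE) auto
  then show ?thesis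
  proof (rule eventually_mono)
    fix x assume "(\<Sum>n. ennreal (X n x)) \<noteq> \<infinity>"
    then have "summable (\<lambda>n. X n x)"
      using nonneg by (intro summable_suminf_not_top) auto
    then show "(\<lambda>n. X n x) \<longlonglongrightarrow> 0"
      by (rule summable_LIMSEQ_zero)
  qed
qed

lemma determined_by_subtree:
  assumes "length v \<ge> n"
  shows "determined_by {u. length u \<ge> n} (\<lambda>c. h (subtree c v))"
  unfolding determined_by_def
proof (intro allI impI)
  fix c c' :: "nat list \<Rightarrow> nat"
  assume "\<forall>u\<in>{u. length u \<ge> n}. c u = c' u"
  then have "subtree c v = subtree c' v"
    using assms by (auto simp: subtree_def)
  then show "h (subtree c v) = h (subtree c' v)"
    by simp
qed

lemma determined_by_sum:
  assumes "\<And>v. v \<in> G \<Longrightarrow> determined_by A (f v)"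
  shows "determined_by A (\<lambda>c. F (\<Sum>v\<in>G. f v c))"
  unfolding determined_by_def
proof (intro allI impI)
  fix c c' :: "nat list \<Rightarrow> nat" assume "\<forall>u\<in>A. c u = c' u"
  then have "(\<Sum>v\<in>G. f v c) = (\<Sum>v\<in>G. f v c')"
    using assms by (intro sum.cong) (auto simp: determined_by_def)
  then show "F (\<Sum>v\<in>G. f v c) = F (\<Sum>v\<in>G. f v c')"
    by simp
qed

text \<open>
  The many-to-one bound: a weight that depends only on \<open>Z\<^sub>n\<close> does not see the subtrees, whose
  functionals all have the expectation of \<open>h\<close>.
\<close>

lemma nn_integral_weighted_gen_sum_le:
  fixes h :: "(nat list \<Rightarrow> nat) \<Rightarrow> ennreal" and w :: "nat \<Rightarrow> ennreal"
  assumes [measurable]: "h \<in> borel_measurable (tree_space p)"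
  shows "(\<integral>\<^sup>+c. w (card (gen c n)) * (\<Sum>v\<in>gen c n. h (subtree c v)) \<partial>tree_space p)
      \<le> (\<integral>\<^sup>+c. w (card (gen c n)) * of_nat (card (gen c n)) \<partial>tree_space p) * (\<integral>\<^sup>+c. h c \<partial>tree_space p)"
proof -
  have "(\<integral>\<^sup>+c. w (card (gen c n)) * (\<Sum>v\<in>gen c n. h (subtree c v)) \<partial>tree_space p)
      \<le> (\<integral>\<^sup>+c. w (card (gen c n)) * of_nat (card (gen c n)) * (\<integral>\<^sup>+c. h c \<partial>tree_space p) \<partial>tree_space p)"
  proof (rule nn_integral_gen_le[where
        \<Psi> = "\<lambda>G c. w (card G) * (\<Sum>v\<in>G. h (subtree c v))" and
        C = "\<lambda>G. w (card G) * of_nat (card G) * (\<integral>\<^sup>+c. h c \<partial>tree_space p)"])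
    fix G :: "nat list set" assume G: "finite G" "G \<subseteq> {u. length u = n}"
    show "determined_by {u. length u \<ge> n} (\<lambda>c. w (card G) * (\<Sum>v\<in>G. h (subtree c v)))"
      using G(2)
      by (intro determined_by_sum[where F = "\<lambda>x. w (card G) * x"] determined_by_subtree[where h = h]) auto
    show "(\<integral>\<^sup>+c. w (card G) * (\<Sum>v\<in>G. h (subtree c v)) \<partial>tree_space p)
        \<le> w (card G) * of_nat (card G) * (\<integral>\<^sup>+c. h c \<partial>tree_space p)"
      by (simp add: nn_integral_cmult nn_integral_sum nn_integral_subtree mult.assoc)
  qed measurable
  also have "\<dots> = (\<integral>\<^sup>+c. w (card (gen c n)) * of_nat (card (gen c n)) \<partial>tree_space p) * (\<integral>\<^sup>+c. h c \<partial>tree_space p)"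
    by (rule nn_integral_multc) measurable
  finally show ?thesis .
qed

lemma AE_offspring_pos:
  assumes "pmf p 0 = 0"
  shows "AE c in tree_space p. \<forall>u. c u \<noteq> 0"
proof -
  have "AE k in measure_pmf p. k \<noteq> 0"
    using assms by (auto simp: set_pmf_iff intro!: AE_pmfI gr0I)
  then have "AE c in tree_space p. c u \<noteq> 0" for u
    by (intro AE_distrD[OF measurable_offspring[of u p]]) (unfold distr_offspring)
  then show ?thesis
    by (simp add: AE_all_countable)
qed

text \<open>
  The inequality between the harmonic and the arithmetic mean, from Cauchy--Schwarz applied to
  \<open>\<surd>x\<close> and \<open>1 / \<surd>x\<close>.
\<close>

lemma inverse_sum_le:
  fixes x :: "'a \<Rightarrow> real"
  assumes "\<And>v. v \<in> G \<Longrightarrow> x v > 0"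
  shows "1 / (\<Sum>v\<in>G. x v) \<le> 1 / (real (card G))\<^sup>2 * (\<Sum>v\<in>G. 1 / x v)"
proof (cases "finite G \<and> G \<noteq> {}")
  case True
  then have pos: "(\<Sum>v\<in>G. x v) > 0" "card G > 0"
    using assms by (auto intro!: sum_pos simp: card_gt_0_iff)
  have "(\<Sum>v\<in>G. sqrt (x v) * sqrt (1 / x v)) = card G"
    using assms by (simp add: real_sqrt_mult[symmetric] less_imp_neq[THEN not_sym])
  then have "(real (card G))\<^sup>2 \<le> (\<Sum>v\<in>G. (sqrt (x v))\<^sup>2) * (\<Sum>v\<in>G. (sqrt (1 / x v))\<^sup>2)"
    by (metis Cauchy_Schwarz_ineq_sum)
  also have "\<dots> = (\<Sum>v\<in>G. x v) * (\<Sum>v\<in>G. 1 / x v)"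
    using assms by (simp add: less_imp_le)
  finally show ?thesis
    using pos by (simp add: divide_simps mult.commute)
qed (auto)

text \<open>
  Exponential growth of the generations, in the only form that is used. As \<open>Z\<^sub>n\<^sub>+\<^sub>1\<close> is the sum of
  \<open>Z\<^sub>n\<close> offspring numbers, \<open>1 / Z\<^sub>n\<^sub>+\<^sub>1\<close> is at most \<open>1 / Z\<^sub>n\<close> times the average of their inverses,
  and an inverse offspring number has expectation at most \<open>(1 + p\<^sub>1) / 2\<close>: it is \<open>1\<close> for a single child and at
  most \<open>1 / 2\<close> otherwise.
\<close>

lemma nn_integral_inverse_card_gen_le:
  assumes p0: "pmf p 0 = 0"
  shows "(\<integral>\<^sup>+c. ennreal (1 / card (gen c n)) \<partial>tree_space p) \<le> ennreal (((1 + pmf p 1) / 2) ^ n)"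
proof (induction n)
  case 0
  interpret prob_space "tree_space p" by (rule prob_space_tree_space)
  show ?case
    using emeasure_space_1 by (simp add: gen_0 del: nn_integral_const) (simp add: emeasure_space_1)
next
  case (Suc n)
  let ?P = "tree_space p" and ?r = "(1 + pmf p 1) / 2"
  let ?h = "\<lambda>c. ennreal (1 / real (c ([] :: nat list)))"
  have h [measurable]: "?h \<in> borel_measurable ?P"
    by (rule measurable_compose[OF measurable_offspring]) simp
  have "(\<integral>\<^sup>+c. ?h c \<partial>?P) = (\<integral>\<^sup>+k. ennreal (1 / real k) \<partial>measure_pmf p)"
    by (rule nn_integral_offspring[where h = "\<lambda>k. ennreal (1 / real k)"])
  also have "\<dots> \<le> (\<integral>\<^sup>+k. ennreal (1 / 2 + 1 / 2 * indicator {1} k) \<partial>measure_pmf p)"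
  proof (rule nn_integral_mono_AE)
    have "AE k in measure_pmf p. k \<noteq> 0"
      using p0 by (auto simp: set_pmf_iff intro!: AE_pmfI gr0I)
    then show "AE k in measure_pmf p. ennreal (1 / real k) \<le> ennreal (1 / 2 + 1 / 2 * indicator {1} k)"
    proof (rule eventually_mono)
      fix k :: nat assume "k \<noteq> 0"
      then show "ennreal (1 / real k) \<le> ennreal (1 / 2 + 1 / 2 * indicator {1} k)"
        by (intro ennreal_leI) (auto simp: indicator_def field_simps)
    qed
  qed
  also have "\<dots> = ennreal ?r"
  proof -
    have "(\<integral>\<^sup>+k. ennreal (1 / 2 + 1 / 2 * indicator {1} k) \<partial>measure_pmf p)
        = ennreal (\<integral>k. 1 / 2 + 1 / 2 * indicator {1} k \<partial>measure_pmf p)"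
      by (intro nn_integral_eq_integral) (auto intro!: measure_pmf.integrable_const_bound[where B = 1] simp: indicator_def)
    moreover have "integrable (measure_pmf p) (\<lambda>k. indicat_real {Suc 0} k / 2)"
      by (intro measure_pmf.integrable_const_bound[where B = 1]) (auto simp: indicator_def)
    then have "(\<integral>k. 1 / 2 + 1 / 2 * indicator {1} k \<partial>measure_pmf p) = ?r"
      by (subst Bochner_Integration.integral_add) (auto simp: measure_pmf_single add_divide_distrib)
    ultimately show ?thesis
      by simp
  qed
  finally have h_le: "(\<integral>\<^sup>+c. ?h c \<partial>?P) \<le> ennreal ?r" .
  have "(\<integral>\<^sup>+c. ennreal (1 / card (gen c (Suc n))) \<partial>?P)
      \<le> (\<integral>\<^sup>+c. ennreal (1 / (real (card (gen c n)))\<^sup>2) * (\<Sum>v\<in>gen c n. ?h (subtree c v)) \<partial>?P)"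
  proof (rule nn_integral_mono_AE, use AE_offspring_pos[OF p0] in \<open>rule eventually_mono\<close>)
    fix c :: "nat list \<Rightarrow> nat" assume c: "\<forall>u. c u \<noteq> 0"
    have "1 / real (card (gen c (Suc n))) \<le> 1 / (real (card (gen c n)))\<^sup>2 * (\<Sum>v\<in>gen c n. 1 / real (c v))"
      using c inverse_sum_le[of "gen c n" "\<lambda>v. real (c v)"] by (simp add: card_gen_Suc)
    moreover have "ennreal (1 / (real (card (gen c n)))\<^sup>2) * (\<Sum>v\<in>gen c n. ?h (subtree c v))
        = ennreal (1 / (real (card (gen c n)))\<^sup>2 * (\<Sum>v\<in>gen c n. 1 / real (c v)))"
      by (subst ennreal_mult) (auto intro!: sum_nonneg)
    ultimately show "ennreal (1 / card (gen c (Suc n)))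
        \<le> ennreal (1 / (real (card (gen c n)))\<^sup>2) * (\<Sum>v\<in>gen c n. ?h (subtree c v))"
      by (simp only: ennreal_leI)
  qed
  also have "\<dots> \<le> (\<integral>\<^sup>+c. ennreal (1 / (real (card (gen c n)))\<^sup>2) * of_nat (card (gen c n)) \<partial>?P) * (\<integral>\<^sup>+c. ?h c \<partial>?P)"
    by (rule nn_integral_weighted_gen_sum_le[OF h, of "\<lambda>k. ennreal (1 / (real k)\<^sup>2)"])
  also have "\<dots> = (\<integral>\<^sup>+c. ennreal (1 / card (gen c n)) \<partial>?P) * (\<integral>\<^sup>+c. ?h c \<partial>?P)"
  proof -
    have "ennreal (1 / (real k)\<^sup>2) * of_nat k = ennreal (1 / real k)" for k
      unfolding ennreal_of_nat_eq_real_of_nat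
      by (subst ennreal_mult[symmetric]) (auto simp: power2_eq_square)
    then show ?thesis
      by simp
  qed
  also have "\<dots> \<le> ennreal (?r ^ n) * ennreal ?r"
    by (intro mult_mono Suc.IH h_le) auto
  also have "\<dots> = ennreal (?r ^ Suc n)"
    by (subst ennreal_mult'[symmetric]) (auto simp: mult.commute)
  finally show ?case .
qed

text \<open>
  Subtrees at distinct vertices of the same depth read disjoint sets of labels, so the cross terms
  vanish, and the variance of each term is at most \<open>E[h\<^sup>2] \<le> K E[h]\<close>. Bounding by \<open>K m\<close> rather than \<open>K\<^sup>2\<close>
  matters: with \<open>K = b\<^sup>n\<close> it leaves one factor \<open>b\<^sup>n\<close>, to be absorbed by \<open>E[1 / Z\<^sub>n]\<close>.
\<close>

lemma second_moment_sum_subtree_le: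
  fixes h :: "(nat list \<Rightarrow> nat) \<Rightarrow> real"
  assumes [measurable]: "h \<in> borel_measurable (tree_space p)"
    and h: "\<And>c. 0 \<le> h c" "\<And>c. h c \<le> K"
    and G: "finite G" "G \<subseteq> {u. length u = n}"
  defines "m \<equiv> (\<integral>c. h c \<partial>tree_space p)"
  shows "(\<integral>\<^sup>+c. ((\<Sum>v\<in>G. h (subtree c v) - m) / card G)\<^sup>2 \<partial>tree_space p) \<le> ennreal (K * m * (1 / card G))"
proof -
  interpret prob_space "tree_space p" by (rule prob_space_tree_space)
  let ?g = "\<lambda>v c. h (subtree c v) - m"
  have K: "K \<ge> 0"
    using h order_trans by blast
  have m: "0 \<le> m" "m \<le> K"
    unfolding m_def using h K by (auto intro!: integral_le_const integral_nonneg_AE integrable_const_bound[where B = K])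
  have g_bd: "\<bar>?g v c\<bar> \<le> K" for v c
    using h[of "subtree c v"] m by (auto simp: abs_le_iff)
  have int_g [simp]: "integrable (tree_space p) (?g v)" for v
    using g_bd by (intro integrable_const_bound[where B = K]) auto
  have int_gg [simp]: "integrable (tree_space p) (\<lambda>c. ?g v c * ?g w c)" for v w
    using g_bd K by (intro integrable_const_bound[where B = "K * K"]) (auto simp: abs_mult intro!: AE_I2 mult_mono)
  have int_h [simp]: "integrable (tree_space p) (\<lambda>c. h (subtree c v))" for v
    using h by (intro integrable_const_bound[where B = K]) auto
  have E_subtree: "(\<integral>c. f (subtree c v) \<partial>tree_space p) = (\<integral>c. f c \<partial>tree_space p)"
    if [measurable]: "f \<in> borel_measurable (tree_space p)" for f :: "_ \<Rightarrow> real" and v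
    using integral_distr[OF measurable_subtree[of v p], of f] by (simp add: distr_subtree)
  have E_g: "(\<integral>c. ?g v c \<partial>tree_space p) = 0" for v
    by (subst Bochner_Integration.integral_diff) (auto simp: E_subtree m_def prob_space[simplified])
  have cross: "(\<integral>c. ?g v c * ?g w c \<partial>tree_space p) = 0" if "v \<in> G" "w \<in> G" "v \<noteq> w" for v w
  proof -
    have det: "determined_by (range (\<lambda>u. v @ u)) (?g v)" for v
      unfolding determined_by_def
    proof (intro allI impI)
      fix c c' :: "nat list \<Rightarrow> nat" assume "\<forall>u\<in>range (\<lambda>u. v @ u). c u = c' u"
      then have "subtree c v = subtree c' v" by (auto simp: subtree_def)
      then show "?g v c = ?g v c'" by simp
    qed
    have "range (\<lambda>u. v @ u) \<inter> range (\<lambda>u. w @ u) = {}"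
      using that G(2) by (auto simp: append_eq_append_conv subset_iff)
    then have "indep_var borel (?g v) borel (?g w)"
      by (intro indep_var_determined_by[OF _ det _ det]) auto
    then show ?thesis
      by (subst indep_var_lebesgue_integral) (auto simp: E_g)
  qed
  have diag: "(\<integral>c. ?g v c * ?g v c \<partial>tree_space p) \<le> K * m" for v
  proof -
    have "(\<integral>c. ?g v c * ?g v c \<partial>tree_space p) = (\<integral>c. (h c - m) * (h c - m) \<partial>tree_space p)"
      by (subst E_subtree[of "\<lambda>c. (h c - m) * (h c - m)", symmetric]) auto
    also have "\<dots> \<le> (\<integral>c. K * h c - 2 * m * h c + m * m \<partial>tree_space p)"
    proof (rule integral_mono)
      show "(h c - m) * (h c - m) \<le> K * h c - 2 * m * h c + m * m" for c
        using mult_right_mono[OF h(2)[of c] h(1)[of c]] by (simp add: algebra_simps)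
    qed (use int_gg[of "[]" "[]"] int_h[of "[]"] in \<open>auto simp: subtree_def\<close>)
    also have "\<dots> = K * m - m * m"
      using int_h[of "[]"] by (simp add: subtree_def prob_space[simplified] m_def)
    also have "\<dots> \<le> K * m" by simp
    finally show ?thesis .
  qed
  have "(\<integral>c. (\<Sum>v\<in>G. ?g v c)\<^sup>2 \<partial>tree_space p) = (\<Sum>v\<in>G. \<Sum>w\<in>G. \<integral>c. ?g v c * ?g w c \<partial>tree_space p)"
    by (simp add: power2_eq_square sum_product)
  also have "\<dots> = (\<Sum>v\<in>G. \<integral>c. ?g v c * ?g v c \<partial>tree_space p)"
  proof (rule sum.cong[OF refl])
    fix v assume v: "v \<in> G"
    have "(\<Sum>w\<in>G. \<integral>c. ?g v c * ?g w c \<partial>tree_space p) = (\<Sum>w\<in>{v}. \<integral>c. ?g v c * ?g w c \<partial>tree_space p)"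
      using v G(1) cross by (intro sum.mono_neutral_right) auto
    then show "(\<Sum>w\<in>G. \<integral>c. ?g v c * ?g w c \<partial>tree_space p) = (\<integral>c. ?g v c * ?g v c \<partial>tree_space p)"
      by simp
  qed
  also have "\<dots> \<le> (\<Sum>v\<in>G. K * m)"
    by (intro sum_mono diag)
  finally have *: "(\<integral>c. (\<Sum>v\<in>G. ?g v c)\<^sup>2 \<partial>tree_space p) \<le> card G * (K * m)"
    by simp
  have int: "integrable (tree_space p) (\<lambda>c. (\<Sum>v\<in>G. ?g v c)\<^sup>2)"
    by (simp add: power2_eq_square sum_product)
  then have "(\<integral>\<^sup>+c. ((\<Sum>v\<in>G. ?g v c) / card G)\<^sup>2 \<partial>tree_space p)
      = ennreal ((\<integral>c. (\<Sum>v\<in>G. ?g v c)\<^sup>2 \<partial>tree_space p) / (card G)\<^sup>2)"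
    by (simp add: power_divide nn_integral_eq_integral)
  also have "\<dots> \<le> ennreal (card G * (K * m) / (card G)\<^sup>2)"
    using * by (intro ennreal_leI divide_right_mono) auto
  also have "card G * (K * m) / (card G)\<^sup>2 = K * m * (1 / card G)"
    by (simp add: power2_eq_square)
  finally show ?thesis .
qed

section \<open>The law of large numbers over generations\<close>

lemma nn_integral_klogk:
  assumes "summable (\<lambda>k. real k * ln (real k) * pmf p k)"
  shows "(\<integral>\<^sup>+k. ennreal (real k * ln (real k)) \<partial>measure_pmf p) < \<infinity>"
proof -
  have pos: "0 \<le> real k * ln (real k)" for k
    by (cases "k = 0") auto
  have "(\<integral>\<^sup>+k. ennreal (real k * ln (real k)) \<partial>measure_pmf p)
      = (\<Sum>k. ennreal (real k * ln (real k) * pmf p k))"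
    unfolding nn_integral_measure_pmf nn_integral_count_space_nat
    by (intro suminf_cong) (simp add: ennreal_mult pos mult.commute)
  also have "\<dots> = ennreal (\<Sum>k. real k * ln (real k) * pmf p k)"
    using assms pos by (intro suminf_ennreal2) auto
  finally show ?thesis
    by simp
qed

lemma nn_integral_offspring_finite:
  assumes "summable (\<lambda>k. real k * ln (real k) * pmf p k)"
  shows "(\<integral>\<^sup>+k. ennreal (real k) \<partial>measure_pmf p) < \<infinity>"
proof -
  have "ennreal (real k) \<le> 3 + ennreal (real k * ln (real k))" for k
  proof -
    have "real k \<le> 3 + real k * ln (real k)"
    \<comment> \<open>For \<open>k > 3 > e\<close> the logarithm is at least \<open>1\<close>.\<close>
    proof (cases "k \<le> 3")
      case True
      moreover have "0 \<le> real k * ln (real k)"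
        by (cases "k = 0") auto
      ultimately show ?thesis by linarith
    next
      case False
      then have "exp 1 \<le> real k"
        using e_less_272 by linarith
      then have "1 \<le> ln (real k)"
        using False by (subst ln_ge_iff) auto
      then have "real k * 1 \<le> real k * ln (real k)"
        by (intro mult_left_mono) auto
      then show ?thesis by simp
    qed
    then have "ennreal (real k) \<le> ennreal (3 + real k * ln (real k))"
      by (rule ennreal_leI)
    also have "\<dots> = ennreal 3 + ennreal (real k * ln (real k))"
      by (rule ennreal_plus) (auto, cases "k = 0", auto)
    finally show ?thesis by simp
  qed
  then have "(\<integral>\<^sup>+k. ennreal (real k) \<partial>measure_pmf p) \<le> (\<integral>\<^sup>+k. 3 + ennreal (real k * ln (real k)) \<partial>measure_pmf p)"
    by (intro nn_integral_mono)
  also have "\<dots> = 3 + (\<integral>\<^sup>+k. ennreal (real k * ln (real k)) \<partial>measure_pmf p)"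
    by (subst nn_integral_add) (auto simp: measure_pmf.emeasure_space_1[simplified])
  also have "\<dots> < \<infinity>"
    using nn_integral_klogk[OF assms] by (simp add: less_top)
  finally show ?thesis .
qed

text \<open>
  A value \<open>k \<ge> 1\<close> exceeds \<open>b\<^sup>n\<close> for at most \<open>1 + ln k / ln b\<close> indices \<open>n\<close>, so it contributes at most
  a multiple of \<open>k + k ln k\<close> to the sum of all tails.
\<close>

lemma suminf_tail_offspring_finite:
  assumes klogk: "summable (\<lambda>k. real k * ln (real k) * pmf p k)" and b: "b > 1"
  shows "(\<Sum>n. \<integral>\<^sup>+k. ennreal (if b ^ n < real k then real k else 0) \<partial>measure_pmf p) < \<infinity>"
proof -
  let ?t = "\<lambda>n k. ennreal (if b ^ n < real k then real k else 0)"
  have ln_b: "ln b > 0"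
    using b by simp
  have "(\<Sum>n. ?t n k) \<le> 2 * ennreal (real k) + ennreal (1 / ln b) * ennreal (real k * ln (real k))" for k
  proof (cases "k = 0")
    case False
    define N where "N = nat \<lceil>ln (real k) / ln b\<rceil>"
    have lnk: "ln (real k) \<ge> 0"
      using False by simp
    have zero: "\<not> b ^ n < real k" if "n \<ge> N" for n
    proof
      assume "b ^ n < real k"
      then have "ln (b ^ n) < ln (real k)"
        using b False by (subst ln_less_cancel_iff) auto
      then have "real n < ln (real k) / ln b"
        using b ln_b by (simp add: ln_realpow field_simps)
      moreover have "ln (real k) / ln b \<le> real N"
        unfolding N_def by linarith
      ultimately show False
        using that by simp
    qed
    have "(\<Sum>n. ?t n k) = (\<Sum>n<N. ?t n k)"
      by (intro suminf_finite) (simp_all add: not_less[of _ N] zero)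
    also have "\<dots> \<le> (\<Sum>n<N. ennreal (real k))"
      by (intro sum_mono ennreal_leI) auto
    also have "\<dots> = ennreal (real N * real k)"
      by (simp add: ennreal_of_nat_eq_real_of_nat ennreal_mult)
    also have "\<dots> \<le> ennreal (2 * real k + 1 / ln b * (real k * ln (real k)))"
    proof (rule ennreal_leI)
      have "real N \<le> ln (real k) / ln b + 1"
      proof -
        have "0 \<le> ln (real k) / ln b"
          using lnk ln_b by simp
        then have "real N = of_int \<lceil>ln (real k) / ln b\<rceil>"
          by (simp add: N_def)
        then show ?thesis
          by linarith
      qed
      then have "real N * real k \<le> (ln (real k) / ln b + 1) * real k"
        by (intro mult_right_mono) auto
      also have "\<dots> \<le> 2 * real k + 1 / ln b * (real k * ln (real k))"
        by (simp add: algebra_simps)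
      finally show "real N * real k \<le> 2 * real k + 1 / ln b * (real k * ln (real k))" .
    qed
    also have "\<dots> = 2 * ennreal (real k) + ennreal (1 / ln b) * ennreal (real k * ln (real k))"
      using lnk ln_b by (simp add: ennreal_plus ennreal_mult del: times_divide_eq_left mult_1)
    finally show ?thesis .
  next
    case True
    then have "?t n k = 0" for n
      by simp
    then show ?thesis
      by simp
  qed
  then have "(\<integral>\<^sup>+k. (\<Sum>n. ?t n k) \<partial>measure_pmf p)
      \<le> (\<integral>\<^sup>+k. 2 * ennreal (real k) + ennreal (1 / ln b) * ennreal (real k * ln (real k)) \<partial>measure_pmf p)"
    by (intro nn_integral_mono)
  also have "\<dots> = 2 * (\<integral>\<^sup>+k. ennreal (real k) \<partial>measure_pmf p)
      + ennreal (1 / ln b) * (\<integral>\<^sup>+k. ennreal (real k * ln (real k)) \<partial>measure_pmf p)"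
    by (simp add: nn_integral_add nn_integral_cmult)
  also have "\<dots> < \<infinity>"
    using nn_integral_klogk[OF klogk] nn_integral_offspring_finite[OF klogk]
    by (simp add: ennreal_mult_less_top less_top)
  finally show ?thesis
    by (simp add: nn_integral_suminf)
qed

lemma integrable_le_offspring:
  fixes h :: "(nat list \<Rightarrow> nat) \<Rightarrow> real"
  assumes klogk: "summable (\<lambda>k. real k * ln (real k) * pmf p k)"
    and [measurable]: "h \<in> borel_measurable (tree_space p)"
    and h: "\<And>c. 0 \<le> h c" "\<And>c. h c \<le> real (c [])"
  shows "integrable (tree_space p) h"
proof (rule integrableI_nonneg)
  have "(\<integral>\<^sup>+c. ennreal (h c) \<partial>tree_space p) \<le> (\<integral>\<^sup>+c. ennreal (real (c [])) \<partial>tree_space p)"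
    by (intro nn_integral_mono ennreal_leI h)
  also have "\<dots> = (\<integral>\<^sup>+k. ennreal (real k) \<partial>measure_pmf p)"
    by (rule nn_integral_offspring[where h = "\<lambda>k. ennreal (real k)"])
  finally show "(\<integral>\<^sup>+c. ennreal (h c) \<partial>tree_space p) < \<infinity>"
    using nn_integral_offspring_finite[OF klogk] by simp
qed (use h in auto)

text \<open>
  Truncation at the deterministic level \<open>b\<^sup>n\<close>, rather than at a power of the random size of the
  generation, keeps all estimates at the level of expectations: the averages \<open>B\<close> of the large
  parts have summable expectations by \<open>suminf_tail_offspring_finite\<close>, and the centred averages \<open>A\<close> of
  the small parts have summable second moments, of order \<open>(b r)\<^sup>n\<close>. The centring constants \<open>m\<close>
  tend to \<open>E[h]\<close>.
\<close>

theorem AE_gen_average_tendsto: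
  fixes h :: "(nat list \<Rightarrow> nat) \<Rightarrow> real"
  assumes klogk: "summable (\<lambda>k. real k * ln (real k) * pmf p k)"
    and p0: "pmf p 0 = 0" and p1: "pmf p 1 < 1"
    and h_meas [measurable]: "h \<in> borel_measurable (tree_space p)"
    and h: "\<And>c. 0 \<le> h c" "\<And>c. h c \<le> real (c [])"
  shows "AE c in tree_space p.
    (\<lambda>n. (\<Sum>v\<in>gen c n. h (subtree c v)) / card (gen c n)) \<longlonglongrightarrow> (\<integral>c. h c \<partial>tree_space p)"
proof -
  let ?P = "tree_space p"
  interpret prob_space ?P by (rule prob_space_tree_space)
  define r where "r = (1 + pmf p 1) / 2"
  \<comment> \<open>A number with \<open>1 < b\<close> and \<open>b r < 1\<close>: the first makes the tails summable, the second the variances.\<close>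
  define b where "b = 2 / (1 + r)"
  have r: "0 < r" "r < 1"
    using p1 pmf_nonneg[of p 1] unfolding r_def by (simp_all add: add_pos_nonneg)
  have b: "b > 1" "b * r < 1"
    using r by (auto simp: b_def field_simps)
  have [measurable]: "(\<lambda>c. real (c [])) \<in> borel_measurable ?P"
    by (rule measurable_compose[OF measurable_offspring]) simp
  define h1 where "h1 n c = (if real (c []) \<le> b ^ n then h c else 0)" for n and c :: "nat list \<Rightarrow> nat"
  define h2 where "h2 n c = (if b ^ n < real (c []) then h c else 0)" for n and c :: "nat list \<Rightarrow> nat"
  have h12: "h c = h1 n c + h2 n c" for n c
    by (auto simp: h1_def h2_def)
  have meas [measurable]: "h1 n \<in> borel_measurable ?P" "h2 n \<in> borel_measurable ?P" for n
    unfolding h1_def h2_def by measurable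
  have h1: "0 \<le> h1 n c" "h1 n c \<le> real (c [])" "h1 n c \<le> b ^ n" for n c
    using h[of c] order.trans[OF h] b(1) by (auto simp: h1_def)
  have h2: "0 \<le> h2 n c" "h2 n c \<le> real (c [])" "h2 n c \<le> (if b ^ n < real (c []) then real (c []) else 0)" for n c
    using h[of c] by (auto simp: h2_def)
  have int: "integrable ?P h" "integrable ?P (h1 n)" "integrable ?P (h2 n)" for n
    by (intro integrable_le_offspring[OF klogk] h h1 h2 h_meas meas)+
  define m where "m n = (\<integral>c. h1 n c \<partial>?P)" for n
  define \<mu> where "\<mu> = (\<integral>c. real (c []) \<partial>?P)"
  have \<mu>: "m n \<le> \<mu>" "0 \<le> m n" for n
    unfolding m_def \<mu>_def using int(2) h1
    by (auto intro!: integral_mono integrable_le_offspring[OF klogk])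
  \<comment> \<open>Centring inside the sum makes this \<open>0\<close>, not \<open>- m n\<close>, on an empty generation, so that the variance bound holds there too.\<close>
  define A where "A n c = (\<Sum>v\<in>gen c n. h1 n (subtree c v) - m n) / card (gen c n)" for n c
  define B where "B n c = (\<Sum>v\<in>gen c n. h2 n (subtree c v)) / card (gen c n)" for n c
  have A_meas [measurable]: "A n \<in> borel_measurable ?P" for n
    unfolding A_def
    by (rule measurable_compose_gen[where f = "\<lambda>G c. (\<Sum>v\<in>G. h1 n (subtree c v) - m n) / card G"]) measurable
  have B_meas [measurable]: "B n \<in> borel_measurable ?P" for n
    unfolding B_def
    by (rule measurable_compose_gen[where f = "\<lambda>G c. (\<Sum>v\<in>G. h2 n (subtree c v)) / card G"]) measurable
  have B_nonneg: "0 \<le> B n c" for n c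
    unfolding B_def by (intro divide_nonneg_nonneg sum_nonneg h2) auto

  have E_h2: "(\<integral>\<^sup>+c. h2 n c \<partial>?P) \<le> (\<integral>\<^sup>+k. ennreal (if b ^ n < real k then real k else 0) \<partial>measure_pmf p)" for n
  proof -
    have "(\<integral>\<^sup>+c. h2 n c \<partial>?P) \<le> (\<integral>\<^sup>+c. ennreal (if b ^ n < real (c []) then real (c []) else 0) \<partial>?P)"
      by (intro nn_integral_mono ennreal_leI h2)
    also have "\<dots> = (\<integral>\<^sup>+k. ennreal (if b ^ n < real k then real k else 0) \<partial>measure_pmf p)"
      by (rule nn_integral_offspring[where h = "\<lambda>k. ennreal (if b ^ n < real k then real k else 0)"])
    finally show ?thesis .
  qed
  have sum_h2: "(\<Sum>n. \<integral>\<^sup>+c. h2 n c \<partial>?P) < \<infinity>"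
    using suminf_tail_offspring_finite[OF klogk b(1)]
    by (rule le_less_trans[rotated]) (intro suminf_le E_h2 summableI)

  have m_lim: "m \<longlonglongrightarrow> (\<integral>c. h c \<partial>?P)"
  proof -
    have "(\<lambda>n. \<integral>c. h2 n c \<partial>?P) \<longlonglongrightarrow> 0"
    proof (rule summable_LIMSEQ_zero)
      have "(\<Sum>n. ennreal (\<integral>c. h2 n c \<partial>?P)) \<noteq> \<infinity>"
        using sum_h2 h2(1) int(3) by (simp add: nn_integral_eq_integral)
      then show "summable (\<lambda>n. \<integral>c. h2 n c \<partial>?P)"
        using h2(1) by (intro summable_suminf_not_top integral_nonneg_AE) auto
    qed
    then have "(\<lambda>n. (\<integral>c. h c \<partial>?P) - (\<integral>c. h2 n c \<partial>?P)) \<longlonglongrightarrow> (\<integral>c. h c \<partial>?P) - 0"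
      by (intro tendsto_intros)
    moreover have "(\<integral>c. h c \<partial>?P) - (\<integral>c. h2 n c \<partial>?P) = m n" for n
      unfolding m_def using int by (simp add: h12[of _ n])
    ultimately show ?thesis by simp
  qed

  have "AE c in ?P. (\<lambda>n. B n c) \<longlonglongrightarrow> 0"
  proof (rule AE_tendsto_0_of_nn_integral_suminf)
    have "(\<integral>\<^sup>+c. B n c \<partial>?P) \<le> (\<integral>\<^sup>+c. h2 n c \<partial>?P)" for n
    proof -
      have "ennreal (B n c) = ennreal (1 / card (gen c n)) * (\<Sum>v\<in>gen c n. ennreal (h2 n (subtree c v)))" for c
        using h2 by (simp add: B_def sum_nonneg ennreal_mult[symmetric])
      then have "(\<integral>\<^sup>+c. B n c \<partial>?P)
          \<le> (\<integral>\<^sup>+c. ennreal (1 / card (gen c n)) * of_nat (card (gen c n)) \<partial>?P) * (\<integral>\<^sup>+c. h2 n c \<partial>?P)"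
        using nn_integral_weighted_gen_sum_le[of "\<lambda>c. ennreal (h2 n c)" p "\<lambda>k. ennreal (1 / real k)" n]
        by simp
      also have "\<dots> \<le> (\<integral>\<^sup>+c. 1 \<partial>?P) * (\<integral>\<^sup>+c. h2 n c \<partial>?P)"
        by (intro mult_right_mono nn_integral_mono)
           (auto simp: ennreal_of_nat_eq_real_of_nat ennreal_mult[symmetric])
      also have "\<dots> = (\<integral>\<^sup>+c. h2 n c \<partial>?P)"
        using emeasure_space_1 by simp
      finally show ?thesis .
    qed
    then show "(\<Sum>n. \<integral>\<^sup>+c. B n c \<partial>?P) < \<infinity>"
      by (intro le_less_trans[OF _ sum_h2] suminf_le summableI)
  qed (simp_all add: B_nonneg)

  moreover have "AE c in ?P. (\<lambda>n. (A n c)\<^sup>2) \<longlonglongrightarrow> 0"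
  proof (rule AE_tendsto_0_of_nn_integral_suminf)
    have "(\<integral>\<^sup>+c. (A n c)\<^sup>2 \<partial>?P) \<le> ennreal (\<mu> * (b * r) ^ n)" for n
    proof -
      have "(\<integral>\<^sup>+c. (A n c)\<^sup>2 \<partial>?P) \<le> (\<integral>\<^sup>+c. ennreal (b ^ n * m n * (1 / card (gen c n))) \<partial>?P)"
        unfolding A_def
      proof (rule nn_integral_gen_le[where
            \<Psi> = "\<lambda>G c. ennreal (((\<Sum>v\<in>G. h1 n (subtree c v) - m n) / card G)\<^sup>2)" and
            C = "\<lambda>G. ennreal (b ^ n * m n * (1 / card G))"])
        fix G :: "nat list set" assume G: "finite G" "G \<subseteq> {u. length u = n}"
        show "determined_by {u. length u \<ge> n} (\<lambda>c. ennreal (((\<Sum>v\<in>G. h1 n (subtree c v) - m n) / card G)\<^sup>2))"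
          using G(2)
          by (intro determined_by_sum[where F = "\<lambda>x. ennreal ((x / card G)\<^sup>2)"]
              determined_by_subtree[where h = "\<lambda>c. h1 n c - m n"]) auto
        show "(\<integral>\<^sup>+c. ennreal (((\<Sum>v\<in>G. h1 n (subtree c v) - m n) / card G)\<^sup>2) \<partial>?P)
            \<le> ennreal (b ^ n * m n * (1 / card G))"
          unfolding m_def by (rule second_moment_sum_subtree_le[OF meas(1) h1(1,3) G])
      qed measurable
      also have "\<dots> = ennreal (b ^ n * m n) * (\<integral>\<^sup>+c. ennreal (1 / card (gen c n)) \<partial>?P)"
      proof -
        have "ennreal (b ^ n * m n * (1 / real k)) = ennreal (b ^ n * m n) * ennreal (1 / real k)" for k
          using b(1) \<mu>(2)[of n] by (intro ennreal_mult) auto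
        then show ?thesis
          by (simp only:)
             (rule nn_integral_cmult[where f = "\<lambda>c. ennreal (1 / real (card (gen c n)))"],
              rule measurable_compose[OF measurable_card_gen[of n p]], simp)
      qed
      also have "\<dots> \<le> ennreal (b ^ n * \<mu>) * ennreal (r ^ n)"
        unfolding r_def using b(1) \<mu>
        by (intro mult_mono nn_integral_inverse_card_gen_le[OF p0] ennreal_leI mult_left_mono) auto
      also have "\<dots> = ennreal (\<mu> * (b * r) ^ n)"
        using b(1) r \<mu>[of n] by (subst ennreal_mult[symmetric]) (auto simp: power_mult_distrib mult_ac)
      finally show ?thesis .
    qed
    then have "(\<Sum>n. \<integral>\<^sup>+c. (A n c)\<^sup>2 \<partial>?P) \<le> (\<Sum>n. ennreal (\<mu> * (b * r) ^ n))"
      by (intro suminf_le summableI)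
    also have "\<dots> = ennreal (\<Sum>n. \<mu> * (b * r) ^ n)"
      using b r \<mu>[of 0] by (intro suminf_ennreal2 summable_mult summable_geometric) auto
    also have "\<dots> < \<infinity>"
      by simp
    finally show "(\<Sum>n. \<integral>\<^sup>+c. (A n c)\<^sup>2 \<partial>?P) < \<infinity>" .
  qed auto

  moreover note AE_offspring_pos[OF p0]
  ultimately show ?thesis
  proof eventually_elim
    case (elim c)
    have "(\<lambda>n. A n c) \<longlonglongrightarrow> 0"
      using tendsto_real_sqrt[OF elim(2)] by (simp add: tendsto_rabs_zero_iff)
    then have "(\<lambda>n. A n c + B n c + m n) \<longlonglongrightarrow> 0 + 0 + (\<integral>c. h c \<partial>?P)"
      using elim(1) m_lim by (intro tendsto_add)
    moreover have "A n c + B n c + m n = (\<Sum>v\<in>gen c n. h (subtree c v)) / card (gen c n)" for n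
    proof -
      have "card (gen c n) > 0"
        using elim by (intro card_gen_pos) auto
      moreover have "(\<Sum>v\<in>gen c n. h (subtree c v))
          = (\<Sum>v\<in>gen c n. h1 n (subtree c v)) + (\<Sum>v\<in>gen c n. h2 n (subtree c v))"
        by (subst h12[of _ n]) (rule sum.distrib)
      ultimately show ?thesis
        by (simp add: A_def B_def sum_subtractf add_divide_distrib diff_divide_distrib card_gt_0_iff)
    qed
    ultimately show ?case by simp
  qed
qed

section \<open>The expected number of children of a given type\<close>

text \<open>
  Both sides are the probability of the same event under the product measure on \<open>I\<close>: on the left by
  \<open>distr_relabel\<close>, on the right because the coordinates of a finite product of mass functions are
  independent.
\<close>

lemma emeasure_sum_offspring:
  assumes I: "finite I" and e: "inj_on e I" and S [measurable]: "S \<in> sets borel"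
  shows "emeasure (tree_space p) {c. (\<Sum>l\<in>I. real (c (e l))) \<in> S}
       = emeasure (measure_pmf (Pi_pmf I d (\<lambda>_. p))) {x. (\<Sum>l\<in>I. real (x l)) \<in> S}"
proof (cases "I = {}")
  case True
  interpret prob_space "tree_space p" by (rule prob_space_tree_space)
  show ?thesis
    using emeasure_space_1 measure_pmf.emeasure_space_1 by (cases "0 \<in> S") (simp_all add: True)
next
  case False
  let ?C = "PiM I (\<lambda>_. count_space (UNIV :: nat set))"
  let ?N = "PiM I (\<lambda>_. measure_pmf p)"
  let ?E = "{x \<in> space ?C. (\<Sum>l\<in>I. real (x l)) \<in> S}"
  have sets_N: "sets ?N = sets ?C"
    by (intro sets_PiM_cong) simp_all
  have "(\<lambda>x. \<Sum>l\<in>I. real (x l)) \<in> borel_measurable ?C"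
    by (intro borel_measurable_sum measurable_compose[OF measurable_component_singleton]) auto
  then have E: "?E \<in> sets ?C"
    by measurable
  have m1: "(\<lambda>c. \<lambda>l\<in>I. c (e l)) \<in> tree_space p \<rightarrow>\<^sub>M ?N"
    unfolding measurable_cong_sets[OF refl sets_N] by (intro measurable_restrict) simp
  have "emeasure ?N ?E = emeasure (tree_space p) ((\<lambda>c. \<lambda>l\<in>I. c (e l)) -` ?E \<inter> space (tree_space p))"
    using emeasure_distr[OF m1, of ?E] E by (simp add: distr_relabel[OF e] sets_N)
  also have "(\<lambda>c. \<lambda>l\<in>I. c (e l)) -` ?E \<inter> space (tree_space p) = {c. (\<Sum>l\<in>I. real (c (e l))) \<in> S}"
    by (auto simp: space_PiM)
  finally have 1: "emeasure ?N ?E = emeasure (tree_space p) {c. (\<Sum>l\<in>I. real (c (e l))) \<in> S}" .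

  let ?Q = "measure_pmf (Pi_pmf I d (\<lambda>_. p))"
  have comp: "distr ?Q (count_space UNIV) (\<lambda>f. f i) = measure_pmf p" if "i \<in> I" for i
    using Pi_pmf_component[OF I, of i d "\<lambda>_. p"] that by (simp add: map_pmf_rep_eq[symmetric])
  have "distr ?Q ?C (\<lambda>x. restrict x I) = PiM I (\<lambda>i. distr ?Q (count_space UNIV) (\<lambda>f. f i))"
    using indep_vars_Pi_pmf[OF I, of d "\<lambda>_. p"] False
    by (subst (asm) prob_space.indep_vars_iff_distr_eq_PiM'[OF measure_pmf.prob_space_axioms]) auto
  also have "\<dots> = ?N"
    by (intro PiM_cong comp refl)
  finally have dN: "distr ?Q ?C (\<lambda>x. restrict x I) = ?N" .
  have "emeasure ?N ?E = emeasure ?Q ((\<lambda>x. restrict x I) -` ?E \<inter> space ?Q)"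
    unfolding dN[symmetric] using E by (intro emeasure_distr) (auto simp: space_PiM)
  also have "(\<lambda>x. restrict x I) -` ?E \<inter> space ?Q = {x. (\<Sum>l\<in>I. real (x l)) \<in> S}"
    by (auto simp: space_PiM)
  finally show ?thesis
    using 1 by simp
qed

text \<open>
  The probability that a vertex with \<open>k\<close> children has type \<open>\<tau>\<close> when its parent has \<open>y\<close> children.
\<close>

definition bias_prob :: "nat pmf \<Rightarrow> real \<Rightarrow> nat \<Rightarrow> nat \<Rightarrow> real" where
  "bias_prob p \<tau> y k = measure_pmf.prob (Pi_pmf {1..k} 0 (\<lambda>_. p))
     {x. sgn (real y + (\<Sum>l=1..k. real (x l)) - real k * (real k + 1)) = \<tau>}"

lemma child_type_measurable [measurable]:
  "(\<lambda>c. child_type c i) \<in> borel_measurable (tree_space p)"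
proof -
  have [measurable]: "(\<lambda>c. real (c u)) \<in> borel_measurable (tree_space p)" for u
    by (rule measurable_compose[OF measurable_offspring]) simp
  let ?f = "\<lambda>k c. sgn (real (c []) + (\<Sum>j<k. real (c [i, j])) - real (c [i]) * (real (c [i]) + 1))"
  have "(\<lambda>c. ?f (c [i]) c) \<in> borel_measurable (tree_space p)"
    by (rule measurable_compose_countable[where f = ?f, OF _ measurable_offspring]) measurable
  then show ?thesis
    by (simp add: child_type_def)
qed

lemma type_count_eq_sum:
  "real (type_count \<tau> c) = (\<Sum>i<c []. if child_type c i = \<tau> then 1 else 0)"
  by (simp add: type_count_def sum.If_cases Int_def)

lemma type_count_measurable [measurable]:
  "(\<lambda>c. real (type_count \<tau> c)) \<in> borel_measurable (tree_space p)"
proof -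
  let ?f = "\<lambda>k c. \<Sum>i<k. if child_type c i = \<tau> then 1 else 0 :: real"
  have "(\<lambda>c. ?f (c []) c) \<in> borel_measurable (tree_space p)"
    by (rule measurable_compose_countable[where f = ?f, OF _ measurable_offspring]) measurable
  then show ?thesis
    by (simp add: type_count_eq_sum)
qed

text \<open>
  The three conditions, on the root, on its child \<open>[i]\<close> and on the children of \<open>[i]\<close>, read disjoint
  sets of labels.
\<close>

lemma nn_integral_family_event:
  "(\<integral>\<^sup>+c. indicator {c. c [] = y \<and> c [i] = k \<and> child_type c i = \<tau>} c \<partial>tree_space p)
     = ennreal (pmf p y * pmf p k * bias_prob p \<tau> y k)"
proof -
  let ?P = "tree_space p"
  let ?S = "{s :: real. sgn (real y + s - real k * (real k + 1)) = \<tau>}"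
  let ?T = "{c :: nat list \<Rightarrow> nat. (\<Sum>j<k. real (c [i, j])) \<in> ?S}"
  let ?I = "\<lambda>u n c. indicator {n} (c u) :: ennreal"
  have [measurable]: "(\<lambda>c. real (c u)) \<in> borel_measurable (tree_space p)" for u
    by (rule measurable_compose[OF measurable_offspring]) simp
  have S: "?S \<in> sets borel"
    by measurable
  have T: "?T \<in> sets ?P"
  proof -
    have "{c \<in> space ?P. (\<Sum>j<k. real (c [i, j])) \<in> ?S} \<in> sets ?P"
      using S by measurable
    then show ?thesis by simp
  qed
  have I_meas: "?I u n \<in> borel_measurable ?P" for u n
    by (rule measurable_compose[OF measurable_offspring]) simp
  have I: "(\<integral>\<^sup>+c. ?I u n c \<partial>?P) = ennreal (pmf p n)" for u n
    using nn_integral_offspring[where h = "indicator {n}" and u = u and p = p] by (simp add: emeasure_pmf_single)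
  have "emeasure ?P ?T = emeasure ?P {c. (\<Sum>l\<in>{1..k}. real (c [i, l - 1])) \<in> ?S}"
    by (simp add: sum.atLeast1_atMost_eq)
  also have "\<dots> = emeasure (measure_pmf (Pi_pmf {1..k} 0 (\<lambda>_. p))) {x. (\<Sum>l\<in>{1..k}. real (x l)) \<in> ?S}"
    by (rule emeasure_sum_offspring[where e = "\<lambda>l. [i, l - 1]"]) (auto simp: inj_on_def S)
  also have "\<dots> = ennreal (bias_prob p \<tau> y k)"
    by (simp add: bias_prob_def measure_pmf.emeasure_eq_measure)
  finally have T_prob: "emeasure ?P ?T = ennreal (bias_prob p \<tau> y k)" .

  have "(\<integral>\<^sup>+c. indicator {c. c [] = y \<and> c [i] = k \<and> child_type c i = \<tau>} c \<partial>?P)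
      = (\<integral>\<^sup>+c. ?I [] y c * (?I [i] k c * indicator ?T c) \<partial>?P)"
    by (intro nn_integral_cong) (auto simp: indicator_def child_type_def)
  also have "\<dots> = (\<integral>\<^sup>+c. ?I [] y c \<partial>?P) * (\<integral>\<^sup>+c. ?I [i] k c * indicator ?T c \<partial>?P)"
    using I_meas T
    by (intro nn_integral_mult_determined_by[where A = "{[]}" and B = "- {[]}"])
       (auto simp: determined_by_def indicator_def)
  also have "(\<integral>\<^sup>+c. ?I [i] k c * indicator ?T c \<partial>?P) = (\<integral>\<^sup>+c. ?I [i] k c \<partial>?P) * (\<integral>\<^sup>+c. indicator ?T c \<partial>?P)"
    using I_meas T
    by (intro nn_integral_mult_determined_by[where A = "{[i]}" and B = "- {[i]}"])
       (auto simp: determined_by_def indicator_def)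
  also have "(\<integral>\<^sup>+c. indicator ?T c \<partial>?P) = ennreal (bias_prob p \<tau> y k)"
    by (rule trans[OF nn_integral_indicator[OF T] T_prob])
  finally show ?thesis
    unfolding I by (simp add: ennreal_mult mult.assoc bias_prob_def)
qed

text \<open>
  Splitting according to the number \<open>y\<close> of children of the root, each of its \<open>y\<close> children has the same
  chance of having type \<open>\<tau>\<close>. Their number is the factor \<open>y\<close> of the size-biased law.
\<close>

lemma nn_integral_type_count:
  "(\<integral>\<^sup>+c. ennreal (real (type_count \<tau> c)) \<partial>tree_space p)
     = (\<integral>\<^sup>+k. \<integral>\<^sup>+y. ennreal (real y * pmf p y * pmf p k * bias_prob p \<tau> y k)
          \<partial>count_space UNIV \<partial>count_space UNIV)"
proof -
  let ?P = "tree_space p" and ?C = "count_space (UNIV :: nat set)"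
  let ?E = "\<lambda>y k i. {c. c [] = y \<and> c [i] = k \<and> child_type c i = \<tau>}"
  have E [measurable]: "?E y k i \<in> sets ?P" for y k i
  proof -
    have "{c \<in> space ?P. c [] = y \<and> c [i] = k \<and> child_type c i = \<tau>} \<in> sets ?P"
      by measurable
    then show ?thesis by simp
  qed
  \<comment> \<open>Only \<open>y = c []\<close> and \<open>k = c [i]\<close> contribute, so both integrals have a single nonzero term.\<close>
  have split: "ennreal (real (type_count \<tau> c)) = (\<integral>\<^sup>+k. \<integral>\<^sup>+y. (\<Sum>i<y. indicator (?E y k i) c) \<partial>?C \<partial>?C)" for c
  proof -
    have "(\<integral>\<^sup>+y. (\<Sum>i<y. indicator (?E y k i) c) \<partial>?C) = (\<Sum>y\<in>{c []}. \<Sum>i<y. indicator (?E y k i) c :: ennreal)" for k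
      by (rule nn_integral_count_space') auto
    then have "(\<integral>\<^sup>+k. \<integral>\<^sup>+y. (\<Sum>i<y. indicator (?E y k i) c) \<partial>?C \<partial>?C)
        = (\<integral>\<^sup>+k. (\<Sum>i<c []. indicator (?E (c []) k i) c) \<partial>?C)"
      by simp
    also have "\<dots> = (\<Sum>i<c []. \<integral>\<^sup>+k. indicator (?E (c []) k i) c \<partial>?C)"
      by (rule nn_integral_sum) simp
    also have "\<dots> = (\<Sum>i<c []. ennreal (if child_type c i = \<tau> then 1 else 0))"
    proof (rule sum.cong[OF refl])
      fix i
      have "(\<integral>\<^sup>+k. indicator (?E (c []) k i) c \<partial>?C) = (\<Sum>k\<in>{c [i]}. indicator (?E (c []) k i) c :: ennreal)"
        by (rule nn_integral_count_space') auto
      then show "(\<integral>\<^sup>+k. indicator (?E (c []) k i) c \<partial>?C) = ennreal (if child_type c i = \<tau> then 1 else 0)"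
        by simp
    qed
    also have "\<dots> = ennreal (real (type_count \<tau> c))"
      unfolding type_count_eq_sum by (rule sum_ennreal) simp
    finally show ?thesis ..
  qed
  have "(\<integral>\<^sup>+c. ennreal (real (type_count \<tau> c)) \<partial>?P)
      = (\<integral>\<^sup>+k. \<integral>\<^sup>+c. \<integral>\<^sup>+y. (\<Sum>i<y. indicator (?E y k i) c) \<partial>?C \<partial>?P \<partial>?C)"
    unfolding split by (intro nn_integral_count_space_nn_integral) (auto simp: nn_integral_count_space_nat)
  also have "\<dots> = (\<integral>\<^sup>+k. \<integral>\<^sup>+y. \<integral>\<^sup>+c. (\<Sum>i<y. indicator (?E y k i) c) \<partial>?P \<partial>?C \<partial>?C)"
    by (intro nn_integral_cong nn_integral_count_space_nn_integral) auto
  also have "\<dots> = (\<integral>\<^sup>+k. \<integral>\<^sup>+y. ennreal (real y * pmf p y * pmf p k * bias_prob p \<tau> y k) \<partial>?C \<partial>?C)"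
  proof (intro nn_integral_cong)
    fix k y
    have "(\<integral>\<^sup>+c. (\<Sum>i<y. indicator (?E y k i) c) \<partial>?P)
        = (\<Sum>i<y. \<integral>\<^sup>+c. indicator (?E y k i) c \<partial>?P)"
      by (rule nn_integral_sum) auto
    also have "\<dots> = of_nat y * ennreal (pmf p y * pmf p k * bias_prob p \<tau> y k)"
      unfolding nn_integral_family_event by simp
    also have "\<dots> = ennreal (real y * pmf p y * pmf p k * bias_prob p \<tau> y k)"
      by (simp add: ennreal_of_nat_eq_real_of_nat ennreal_mult mult.assoc bias_prob_def)
    finally show "(\<integral>\<^sup>+c. (\<Sum>i<y. indicator (?E y k i) c) \<partial>?P)
        = ennreal (real y * pmf p y * pmf p k * bias_prob p \<tau> y k)" .
  qed
  finally show ?thesis .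
qed

lemma summable_offspring:
  assumes "summable (\<lambda>k. real k * ln (real k) * pmf p k)"
  shows "summable (\<lambda>k. real k * pmf p k)"
proof (rule summable_suminf_not_top)
  have "(\<integral>\<^sup>+k. ennreal (real k) \<partial>measure_pmf p) = (\<Sum>k. ennreal (real k * pmf p k))"
    unfolding nn_integral_measure_pmf nn_integral_count_space_nat
    by (intro suminf_cong) (simp add: ennreal_mult mult.commute)
  then show "(\<Sum>k. ennreal (real k * pmf p k)) \<noteq> top"
    using nn_integral_offspring_finite[OF assms] by simp
qed simp

lemma nn_integral_root_offspring:
  assumes "summable (\<lambda>k. real k * ln (real k) * pmf p k)"
  shows "(\<integral>\<^sup>+c. ennreal (real (c u)) \<partial>tree_space p) = ennreal (pmf_mean p)"
proof -
  have "(\<integral>\<^sup>+c. ennreal (real (c u)) \<partial>tree_space p) = (\<Sum>k. ennreal (real k * pmf p k))"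
    unfolding nn_integral_offspring[where h = "\<lambda>k. ennreal (real k)"]
      nn_integral_measure_pmf nn_integral_count_space_nat
    by (intro suminf_cong) (simp add: ennreal_mult mult.commute)
  also have "\<dots> = ennreal (pmf_mean p)"
    unfolding pmf_mean_def by (intro suminf_ennreal2 summable_offspring assms) auto
  finally show ?thesis .
qed

lemma emeasure_pair_pmf_bias:
  "emeasure (measure_pmf (pair_pmf q (Pi_pmf {1..k} 0 (\<lambda>_. p))))
      {(y, x). sgn (real y + (\<Sum>l=1..k. real (x l)) - real k * (real k + 1)) = \<tau>}
   = (\<integral>\<^sup>+y. ennreal (bias_prob p \<tau> y k) \<partial>measure_pmf q)"
  (is "emeasure (measure_pmf (pair_pmf q ?R)) ?X = _")
proof -
  have "emeasure (measure_pmf (pair_pmf q ?R)) ?X = (\<integral>\<^sup>+z. indicator ?X z \<partial>measure_pmf (pair_pmf q ?R))"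
    by simp
  also have "\<dots> = (\<integral>\<^sup>+y. \<integral>\<^sup>+x. indicator ?X (y, x) \<partial>measure_pmf ?R \<partial>measure_pmf q)"
    by (rule nn_integral_pair_pmf')
  also have "\<dots> = (\<integral>\<^sup>+y. ennreal (bias_prob p \<tau> y k) \<partial>measure_pmf q)"
  proof (rule nn_integral_cong)
    fix y
    let ?Y = "{x :: nat \<Rightarrow> nat. sgn (real y + (\<Sum>l=1..k. real (x l)) - real k * (real k + 1)) = \<tau>}"
    have "(\<integral>\<^sup>+x. indicator ?X (y, x) \<partial>measure_pmf ?R) = (\<integral>\<^sup>+x. indicator ?Y x \<partial>measure_pmf ?R)"
      by (intro nn_integral_cong) (simp add: indicator_def)
    also have "\<dots> = emeasure (measure_pmf ?R) ?Y"
      by (rule nn_integral_indicator) simp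
    also have "\<dots> = ennreal (bias_prob p \<tau> y k)"
      by (simp add: bias_prob_def measure_pmf.emeasure_eq_measure)
    finally show "(\<integral>\<^sup>+x. indicator ?X (y, x) \<partial>measure_pmf ?R) = ennreal (bias_prob p \<tau> y k)" .
  qed
  finally show ?thesis .
qed

text \<open>
  The weight \<open>y p\<^sub>y\<close> in \<open>nn_integral_type_count\<close> is \<open>\<mu>\<close> times the size-biased mass function, so \<open>\<mu>\<close> times the
  given series equals the expectation of \<open>type_count \<tau>\<close> term by term.
\<close>

lemma type_frequency_sums:
  assumes klogk: "summable (\<lambda>k. real k * ln (real k) * pmf p k)" and p0: "pmf p 0 = 0"
    and \<mu>: "pmf_mean p > 0"
  shows "(\<lambda>k. pmf p k *
          measure_pmf.prob (pair_pmf (size_biased p) (Pi_pmf {1..k} 0 (\<lambda>_. p)))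
            {(y, x). sgn (real y + (\<Sum>l=1..k. real (x l)) - real k * (real k + 1)) = \<tau>})
        sums ((\<integral>c. real (type_count \<tau> c) \<partial>tree_space p) / pmf_mean p)"
    (is "?a sums (?EY / _)")
proof -
  let ?C = "count_space (UNIV :: nat set)"
  have nonneg: "?a k \<ge> 0" for k
    by simp
  have a: "ennreal (pmf_mean p * ?a k)
      = (\<integral>\<^sup>+y. ennreal (real y * pmf p y * pmf p k * bias_prob p \<tau> y k) \<partial>?C)" for k
  proof -
    have "ennreal (pmf_mean p * ?a k)
        = ennreal (pmf_mean p * pmf p k) * (\<integral>\<^sup>+y. ennreal (bias_prob p \<tau> y k) \<partial>measure_pmf (size_biased p))"
      unfolding emeasure_pair_pmf_bias[symmetric] measure_pmf.emeasure_eq_measure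
      using \<mu> by (simp add: ennreal_mult[symmetric] mult.assoc)
    also have "\<dots> = (\<integral>\<^sup>+y. ennreal (pmf_mean p * pmf p k) *
        (ennreal (real y * pmf p y / pmf_mean p) * ennreal (bias_prob p \<tau> y k)) \<partial>?C)"
      unfolding nn_integral_measure_pmf
      by (subst nn_integral_cmult) (simp_all add: pmf_size_biased[OF summable_offspring[OF klogk]] p0)
    also have "\<dots> = (\<integral>\<^sup>+y. ennreal (real y * pmf p y * pmf p k * bias_prob p \<tau> y k) \<partial>?C)"
      using \<mu> by (intro nn_integral_cong) (simp add: ennreal_mult[symmetric] bias_prob_def)
    finally show ?thesis .
  qed
  have int: "integrable (tree_space p) (\<lambda>c. real (type_count \<tau> c))"
    by (intro integrable_le_offspring[OF klogk]) (auto simp: type_count_le)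
  have "(\<Sum>k. ennreal (pmf_mean p * ?a k)) = (\<integral>\<^sup>+c. ennreal (real (type_count \<tau> c)) \<partial>tree_space p)"
    unfolding a nn_integral_type_count by (rule nn_integral_count_space_nat[symmetric])
  also have "\<dots> = ennreal ?EY"
    using int by (rule nn_integral_eq_integral) simp
  finally have eq: "(\<Sum>k. ennreal (pmf_mean p * ?a k)) = ennreal ?EY" .
  have summ: "summable (\<lambda>k. pmf_mean p * ?a k)"
    using nonneg \<mu> by (intro summable_suminf_not_top) (auto simp only: eq mult_nonneg_nonneg less_imp_le ennreal_neq_top)
  have "ennreal (\<Sum>k. pmf_mean p * ?a k) = ennreal ?EY"
    using nonneg \<mu> by (subst suminf_ennreal2[OF _ summ, symmetric]) (simp_all only: eq mult_nonneg_nonneg less_imp_le)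
  then have "(\<Sum>k. pmf_mean p * ?a k) = ?EY"
  proof (subst (asm) ennreal_inj)
    show "(\<Sum>k. pmf_mean p * ?a k) \<ge> 0"
      using less_imp_le[OF \<mu>] by (intro suminf_nonneg[OF summ]) simp
  qed auto
  with summ have "(\<lambda>k. pmf_mean p * ?a k) sums ?EY"
    by (simp add: sums_iff)
  from sums_divide[OF this, of "pmf_mean p"] show ?thesis
    using \<mu> by simp
qed

lemma pmf_mean_pos:
  assumes klogk: "summable (\<lambda>k. real k * ln (real k) * pmf p k)" and p0: "pmf p 0 = 0"
  shows "pmf_mean p > 0"
proof -
  obtain k where k: "k \<in> set_pmf p"
    using set_pmf_not_empty[of p] by blast
  then have "k \<noteq> 0" "pmf p k > 0"
    using p0 by (auto simp: set_pmf_iff pmf_pos intro!: gr0I)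
  then show ?thesis
    unfolding pmf_mean_def by (intro suminf_pos2[OF summable_offspring[OF klogk], of k]) auto
qed

text \<open>
  The two instances of the law of large numbers are divided by each other. Counting types
  through subtrees at the parents is correct from generation \<open>2\<close> on, which determines the limit.
\<close>

theorem AE_type_frequency:
  assumes klogk: "summable (\<lambda>k. real k * ln (real k) * pmf p k)"
    and p0: "pmf p 0 = 0" and p1: "pmf p 1 < 1"
  shows "AE c in tree_space p. (\<lambda>m. real (N_type c \<tau> m) / real (N_total c m))
    \<longlonglongrightarrow> (\<integral>c. real (type_count \<tau> c) \<partial>tree_space p) / pmf_mean p"
proof -
  let ?P = "tree_space p"
  have [measurable]: "(\<lambda>c. real (c [])) \<in> borel_measurable ?P"
    by (rule measurable_compose[OF measurable_offspring]) simp
  note \<mu> = pmf_mean_pos[OF klogk p0]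
  have "(\<integral>c. real (c []) \<partial>?P) = pmf_mean p"
    using nn_integral_root_offspring[OF klogk, of "[]"] \<mu>
    by (intro integral_eq_nn_integral[THEN trans]) auto
  then have "AE c in ?P. (\<lambda>n. (\<Sum>v\<in>gen c n. real (subtree c v [])) / card (gen c n)) \<longlonglongrightarrow> pmf_mean p"
    using AE_gen_average_tendsto[OF klogk p0 p1, of "\<lambda>c. real (c [])"] by simp
  moreover have "AE c in ?P. (\<lambda>n. (\<Sum>v\<in>gen c n. real (type_count \<tau> (subtree c v))) / card (gen c n))
      \<longlonglongrightarrow> (\<integral>c. real (type_count \<tau> c) \<partial>?P)"
    by (intro AE_gen_average_tendsto[OF klogk p0 p1]) (auto simp: type_count_le)
  moreover note AE_offspring_pos[OF p0]
  ultimately show ?thesis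
  proof eventually_elim
    case (elim c)
    let ?Z = "\<lambda>n. real (card (gen c n))"
    let ?t = "\<lambda>n. real (card {u \<in> gen c n. sgn (friendship_bias c u) = \<tau>})"
    let ?L = "(\<integral>c. real (type_count \<tau> c) \<partial>?P) / pmf_mean p"
    have Z: "?Z n \<ge> 1" for n
      using card_gen_pos[of c n] elim(3) by (simp add: Suc_le_eq)
    have "(\<lambda>n. ((\<Sum>v\<in>gen c n. real (type_count \<tau> (subtree c v))) / ?Z n)
        / ((\<Sum>v\<in>gen c n. real (subtree c v [])) / ?Z n)) \<longlonglongrightarrow> ?L"
      using elim(1,2) \<mu> by (intro tendsto_divide) auto
    also have "(\<lambda>n. ((\<Sum>v\<in>gen c n. real (type_count \<tau> (subtree c v))) / ?Z n)
        / ((\<Sum>v\<in>gen c n. real (subtree c v [])) / ?Z n)) \<longlonglongrightarrow> ?L \<longleftrightarrow> (\<lambda>n. ?t (Suc n) / ?Z (Suc n)) \<longlonglongrightarrow> ?L"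
    proof (rule tendsto_cong, rule eventually_mono[OF eventually_gt_at_top[of 0]])
      fix n :: nat assume "n > 0"
      then show "((\<Sum>v\<in>gen c n. real (type_count \<tau> (subtree c v))) / ?Z n)
        / ((\<Sum>v\<in>gen c n. real (subtree c v [])) / ?Z n) = ?t (Suc n) / ?Z (Suc n)"
        using Z[of n] by (simp add: card_type_gen_Suc card_gen_Suc)
    qed
    finally have "(\<lambda>n. ?t n / ?Z n) \<longlonglongrightarrow> ?L"
      by (rule LIMSEQ_imp_Suc)
    moreover have "\<not> summable ?Z"
    proof
      assume "summable ?Z"
      then have "?Z \<longlonglongrightarrow> 0"
        by (rule summable_LIMSEQ_zero)
      then have "1 \<le> (0 :: real)"
        using Z by (intro LIMSEQ_le_const) auto
      then show False by simp
    qed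
    moreover have "?Z n > 0" for n
      using Z[of n] by linarith
    ultimately have "(\<lambda>m. (\<Sum>n\<le>m. ?t n) / (\<Sum>n\<le>m. ?Z n)) \<longlonglongrightarrow> ?L"
      by (intro ratio_of_sums_tendsto)
    then show ?case
      by (simp add: N_type_eq N_total_eq)
  qed
qed

lemma distr_iid_family:
  fixes \<xi> :: "nat list \<Rightarrow> 'w \<Rightarrow> nat"
  assumes prob: "prob_space M"
    and indep: "prob_space.indep_vars M (\<lambda>_. count_space UNIV) \<xi> UNIV"
    and law: "\<And>u. distr M (count_space UNIV) (\<xi> u) = measure_pmf p"
  shows "(\<lambda>\<omega> u. \<xi> u \<omega>) \<in> M \<rightarrow>\<^sub>M tree_space p"
    and "distr M (tree_space p) (\<lambda>\<omega> u. \<xi> u \<omega>) = tree_space p"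
proof -
  interpret prob_space M by (rule prob)
  have rv: "\<xi> u \<in> M \<rightarrow>\<^sub>M count_space UNIV" for u
    using indep by (simp add: indep_vars_def)
  then show "(\<lambda>\<omega> u. \<xi> u \<omega>) \<in> M \<rightarrow>\<^sub>M tree_space p"
    by (intro measurable_into_tree_space)
  have "distr M (PiM UNIV (\<lambda>_. count_space UNIV)) (\<lambda>\<omega>. \<lambda>u\<in>UNIV. \<xi> u \<omega>) = tree_space p"
    using indep rv
    by (subst (asm) indep_vars_iff_distr_eq_PiM) (simp_all add: law tree_space_def)
  moreover have "distr M (tree_space p) (\<lambda>\<omega> u. \<xi> u \<omega>)
      = distr M (PiM UNIV (\<lambda>_. count_space UNIV)) (\<lambda>\<omega> u. \<xi> u \<omega>)"
    by (rule distr_cong) (simp_all add: sets_tree_space)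
  ultimately show "distr M (tree_space p) (\<lambda>\<omega> u. \<xi> u \<omega>) = tree_space p"
    by (simp add: restrict_UNIV)
qed

theorem theorem1p4:
  fixes p :: "nat pmf"
    and M :: "'w measure"
    and \<xi> :: "nat list \<Rightarrow> 'w \<Rightarrow> nat"
  assumes klogk: "summable (\<lambda>k. real k * ln (real k) * pmf p k)"
    and p0: "pmf p 0 = 0"
    and p1: "pmf p 1 < 1"
    and prob: "prob_space M"
    and indep: "prob_space.indep_vars M (\<lambda>_. count_space UNIV) \<xi> UNIV"
    and law: "\<And>u. distr M (count_space UNIV) (\<xi> u) = measure_pmf p"
  shows "\<exists>f :: real \<Rightarrow> real. \<forall>\<tau>\<in>{-1, 0, 1}.
      (AE \<omega> in M. (\<lambda>m. real (N_type (\<lambda>u. \<xi> u \<omega>) \<tau> m) / real (N_total (\<lambda>u. \<xi> u \<omega>) m))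
          \<longlonglongrightarrow> f \<tau>) \<and>
      (\<lambda>k. pmf p k *
          measure_pmf.prob (pair_pmf (size_biased p) (Pi_pmf {1..k} 0 (\<lambda>_. p)))
            {(y, x). sgn (real y + (\<Sum>l=1..k. real (x l)) - real k * (real k + 1)) = \<tau>})
        sums f \<tau>"
proof (intro exI[of _ "\<lambda>\<tau>. (\<integral>c. real (type_count \<tau> c) \<partial>tree_space p) / pmf_mean p"] ballI conjI)
  fix \<tau> :: real
  note transfer = distr_iid_family[OF prob indep law]
  show "AE \<omega> in M. (\<lambda>m. real (N_type (\<lambda>u. \<xi> u \<omega>) \<tau> m) / real (N_total (\<lambda>u. \<xi> u \<omega>) m))
      \<longlonglongrightarrow> (\<integral>c. real (type_count \<tau> c) \<partial>tree_space p) / pmf_mean p"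
    by (rule AE_distrD[OF transfer(1)], unfold transfer(2)) (rule AE_type_frequency[OF klogk p0 p1])
  show "(\<lambda>k. pmf p k *
          measure_pmf.prob (pair_pmf (size_biased p) (Pi_pmf {1..k} 0 (\<lambda>_. p)))
            {(y, x). sgn (real y + (\<Sum>l=1..k. real (x l)) - real k * (real k + 1)) = \<tau>})
        sums ((\<integral>c. real (type_count \<tau> c) \<partial>tree_space p) / pmf_mean p)"
    by (rule type_frequency_sums[OF klogk p0 pmf_mean_pos[OF klogk p0]])
qed

end
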